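(* Let $X$ be a connected simplicial set and let $\gamma:X_2\to\mathbb{Z}_d$ be a normalized $2$-cocycle. The assignment $e_{a,x}\mapsto J^ae_x$ (for $(a,x)\in\mathbb{Z}_d\times X_1=(X_\gamma)_1$) defines an isomorphism of groups $$\pi_1(\mathbb{Z}_d,X_\gamma)\to\Gamma(A_X,b_\gamma).$$ Moreover, for two (normalized) cocycles $\gamma$ and $\gamma'$ such that $[\gamma]=[\gamma']$ in $H^2(X,\mathbb{Z}_d)$, there is an isomorphism $\Gamma(A_X,b_\gamma)\cong\Gamma(A_X,b_{\gamma'})$.
   Context: Let $d>1$ be an integer; cohomology is simplicial cohomology with $\mathbb{Z}_d$ coefficients. A simplicial set is connected if any two vertices are joined by a finite sequence of edges (traversed in either direction). A $2$-cocycle $\gamma:X_2\to\mathbb{Z}_d$ is normalized if $\gamma(s_0x)=\gamma(s_1x)=0$ for all $x\in X_1$. Twisted product: $X_\gamma=N\mathbb{Z}_d\times_\gamma X$ has $n$-simplices $\mathbb{Z}_d^n\times X_n$, with $d_i(\alpha,\tau)=(d_i\alpha,d_i\tau)$ for $1\le i\le n$, $s_j(\alpha,\tau)=(s_j\alpha,s_j\tau)$, and $d_0(\alpha,\tau)=(\eta(\tau)+d_0\alpha,d_0\tau)$. Here the structure maps on $\alpha$ are those of the nerve $N\mathbb{Z}_d$, and $\eta:X_n\to\mathbb{Z}_d^{n-1}$ is the twisting function determined by $\gamma$: $\eta(\sigma)=\gamma(\sigma)$ for $n=2$, and in general, writing $\tau|_{ijk}$ for the $2$-dimensional face of $\tau\in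 X_n$ on vertices $i,j,k$, $\eta(\tau)_1=\gamma(\tau|_{012})$ and $\eta(\tau)_i=\gamma(\tau|_{0,i,i+1})-\gamma(\tau|_{1,i,i+1})$ for $2\le i\le n-1$. In particular $d_0((a,b),\sigma)=(\gamma(\sigma)+b,d_0\sigma)$ for $\sigma\in X_2$. For a simplicial set $Y$, $\pi_1(\mathbb{Z}_d,Y)$ is the group generated by $e_y$, $y\in Y_1$, with relations: $e_y^d=1$ for all $y\in Y_1$; $[e_{d_i\sigma},e_{d_j\sigma}]=1$ and $e_{d_2\sigma}e_{d_0\sigma}=e_{d_1\sigma}$ for all $\sigma\in Y_2$, $i,j\in\{0,1,2\}$. The generator of $\pi_1(\mathbb{Z}_d,X_\gamma)$ for $(a,x)\in\mathbb{Z}_d\times X_1$ is written $e_{a,x}$. The linear system $(A_X,b_\gamma)$ has rows indexed by $X_2$ and columns indexed by $X_1$, with $(A_X)_{\sigma,x}=\sum_{0\le i\le2,\ d_i\sigma=x}(-1)^i\in\mathbb{Z}_d$ and $(b_\gamma)_\sigma=-\gamma(\sigma)$. The solution group $\Gamma(A_X,b_\gamma)$ is generated by $J$ and $e_x$, $x\in X_1$, with relations: $J^d=e_x^d=1$; $J$ commutes with every $e_x$; for every $\sigma\in X_2$ the elements $e_x$ with $(A_X)_{\sigma,x}\ne0$ pairwise commute; and $\prod_{x:(A_X)_{\sigma,x}\neq0}e_x^{(A_X)_{\sigma,x}}=J^{-\gamma(\sigma)}$ for every $\sigma\in X_2$. *)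

theory Defs
  imports "HOL-Algebra.Product_Groups"
begin

section \<open>Simplicial sets\<close>

text \<open>
  \<open>face Y n i\<close> is \<open>d\<^sub>i\<close> on \<open>n\<close>-simplices and \<open>degen Y n j\<close> is \<open>s\<^sub>j\<close> on \<open>n\<close>-simplices. The sets
  \<open>simplices Y n\<close> for different \<open>n\<close> share a type but need not be disjoint.
\<close>

record 'a sset =
  simplices :: "nat \<Rightarrow> 'a set"
  face :: "nat \<Rightarrow> nat \<Rightarrow> 'a \<Rightarrow> 'a"
  degen :: "nat \<Rightarrow> nat \<Rightarrow> 'a \<Rightarrow> 'a"

definition simplicial_set :: "'a sset \<Rightarrow> bool" where
  "simplicial_set Y \<longleftrightarrow>
    (\<forall>n. \<forall>i\<le>Suc n. face Y (Suc n) i \<in> simplices Y (Suc n) \<rightarrow> simplices Y n) \<and>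
    (\<forall>n. \<forall>j\<le>n. degen Y n j \<in> simplices Y n \<rightarrow> simplices Y (Suc n)) \<and>
    (\<forall>n. \<forall>x\<in>simplices Y (Suc (Suc n)). \<forall>j\<le>Suc (Suc n). \<forall>i<j.
      face Y (Suc n) i (face Y (Suc (Suc n)) j x) =
      face Y (Suc n) (j - 1) (face Y (Suc (Suc n)) i x)) \<and>
    (\<forall>n. \<forall>x\<in>simplices Y n. \<forall>j\<le>n. \<forall>i<j.
      face Y (Suc n) i (degen Y n j x) = degen Y (n - 1) (j - 1) (face Y n i x)) \<and>
    (\<forall>n. \<forall>x\<in>simplices Y n. \<forall>j\<le>n.
      face Y (Suc n) j (degen Y n j x) = x \<and> face Y (Suc n) (Suc j) (degen Y n j x) = x) \<and>
    (\<forall>n. \<forall>x\<in>simplices Y n. \<forall>j\<le>n. \<forall>i\<le>Suc n. Suc j < i \<longrightarrow>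
      face Y (Suc n) i (degen Y n j x) = degen Y (n - 1) j (face Y n (i - 1) x)) \<and>
    (\<forall>n. \<forall>x\<in>simplices Y n. \<forall>j\<le>n. \<forall>i\<le>j.
      degen Y (Suc n) i (degen Y n j x) = degen Y (Suc n) (Suc j) (degen Y n i x))"

text \<open>
  An edge \<open>x\<close> runs from \<open>d\<^sub>1 x\<close> to \<open>d\<^sub>0 x\<close>. As usual, a connected simplicial set is nonempty.
\<close>

definition connected_sset :: "'a sset \<Rightarrow> bool" where
  "connected_sset Y \<longleftrightarrow> simplices Y 0 \<noteq> {} \<and>
    (let E = {(face Y 1 1 x, face Y 1 0 x) | x. x \<in> simplices Y 1}
     in \<forall>u\<in>simplices Y 0. \<forall>v\<in>simplices Y 0. (u, v) \<in> (E \<union> E\<inverse>)\<^sup>*)"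

text \<open>
  The face of an \<open>n\<close>-simplex spanned by the vertices in \<open>V\<close>: the remaining vertices are deleted in
  descending order, so that a vertex \<open>i\<close> still has index \<open>i\<close> when \<open>d\<^sub>i\<close> deletes it.
\<close>

definition face_on :: "'a sset \<Rightarrow> nat \<Rightarrow> nat set \<Rightarrow> 'a \<Rightarrow> 'a" where
  "face_on Y n V \<tau> =
    snd (fold (\<lambda>i (m, \<rho>). (m - 1, face Y m i \<rho>)) (rev (sorted_list_of_set ({0..n} - V))) (n, \<tau>))"


section \<open>Simplicial cohomology with coefficients in the integers modulo \<open>d\<close>\<close>

text \<open>The group of integers modulo \<open>d\<close> is \<^const>\<open>integer_mod_group\<close>, with carrier \<open>{0..<d}\<close>.\<close>

definition cochains :: "nat \<Rightarrow> 'a sset \<Rightarrow> nat \<Rightarrow> ('a \<Rightarrow> int) monoid" where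
  "cochains d Y n = product_group (simplices Y n) (\<lambda>_. integer_mod_group d)"

definition cobd :: "nat \<Rightarrow> 'a sset \<Rightarrow> nat \<Rightarrow> ('a \<Rightarrow> int) \<Rightarrow> 'a \<Rightarrow> int" where
  "cobd d Y n f =
    (\<lambda>\<sigma>\<in>simplices Y (Suc n). (\<Sum>i\<le>Suc n. (-1) ^ i * f (face Y (Suc n) i \<sigma>)) mod int d)"

definition cocycles :: "nat \<Rightarrow> 'a sset \<Rightarrow> nat \<Rightarrow> ('a \<Rightarrow> int) set" where
  "cocycles d Y n = kernel (cochains d Y n) (cochains d Y (Suc n)) (cobd d Y n)"

definition coboundaries :: "nat \<Rightarrow> 'a sset \<Rightarrow> nat \<Rightarrow> ('a \<Rightarrow> int) set" where
  "coboundaries d Y n =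
    (case n of 0 \<Rightarrow> {\<one>\<^bsub>cochains d Y 0\<^esub>}
     | Suc m \<Rightarrow> cobd d Y m ` carrier (cochains d Y m))"

definition cocycle_group :: "nat \<Rightarrow> 'a sset \<Rightarrow> nat \<Rightarrow> ('a \<Rightarrow> int) monoid" where
  "cocycle_group d Y n = (cochains d Y n)\<lparr>carrier := cocycles d Y n\<rparr>"

definition cohomology :: "nat \<Rightarrow> 'a sset \<Rightarrow> nat \<Rightarrow> ('a \<Rightarrow> int) set monoid" where
  "cohomology d Y n = cocycle_group d Y n Mod coboundaries d Y n"

definition coho_class :: "nat \<Rightarrow> 'a sset \<Rightarrow> nat \<Rightarrow> ('a \<Rightarrow> int) \<Rightarrow> ('a \<Rightarrow> int) set" where
  "coho_class d Y n f = coboundaries d Y n #>\<^bsub>cocycle_group d Y n\<^esub> f"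

lemma coho_class_in_cohomology:
  "f \<in> cocycles d Y n \<Longrightarrow> coho_class d Y n f \<in> carrier (cohomology d Y n)"
  by (auto simp: coho_class_def cohomology_def FactGroup_def RCOSETS_def cocycle_group_def)

definition normalized_2cocycle :: "nat \<Rightarrow> 'a sset \<Rightarrow> ('a \<Rightarrow> int) \<Rightarrow> bool" where
  "normalized_2cocycle d Y \<gamma> \<longleftrightarrow> \<gamma> \<in> cocycles d Y 2 \<and>
    (\<forall>x\<in>simplices Y 1. \<gamma> (degen Y 1 0 x) = 0 \<and> \<gamma> (degen Y 1 1 x) = 0)"


section \<open>The twisted product\<close>

text \<open>An \<open>n\<close>-simplex of the nerve is a list of length \<open>n\<close> with entries in \<open>{0..<d}\<close>.\<close>

definition nerve :: "nat \<Rightarrow> int list sset" where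
  "nerve d = \<lparr>
    simplices = (\<lambda>n. {\<alpha>. length \<alpha> = n \<and> set \<alpha> \<subseteq> carrier (integer_mod_group d)}),
    face = (\<lambda>n i \<alpha>.
      if i = 0 then tl \<alpha>
      else if i = n then butlast \<alpha>
      else take (i - 1) \<alpha> @ [(\<alpha> ! (i - 1)) \<otimes>\<^bsub>integer_mod_group d\<^esub> (\<alpha> ! i)] @ drop (i + 1) \<alpha>),
    degen = (\<lambda>n j \<alpha>. take j \<alpha> @ [\<one>\<^bsub>integer_mod_group d\<^esub>] @ drop j \<alpha>)\<rparr>"

text \<open>
  The twisting function on \<open>n\<close>-simplices, a list of length \<open>n - 1\<close> whose \<open>i\<close>-th entry, counted
  from 1, is \<open>\<eta>(\<tau>)\<^sub>i\<close>.
\<close>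

definition twisting :: "nat \<Rightarrow> 'a sset \<Rightarrow> ('a \<Rightarrow> int) \<Rightarrow> nat \<Rightarrow> 'a \<Rightarrow> int list" where
  "twisting d Y \<gamma> n \<tau> =
    map (\<lambda>i. if i = 1 then \<gamma> (face_on Y n {0, 1, 2} \<tau>)
             else (\<gamma> (face_on Y n {0, i, i + 1} \<tau>) - \<gamma> (face_on Y n {1, i, i + 1} \<tau>)) mod int d)
        [1..<n]"

definition twisted_product :: "nat \<Rightarrow> 'a sset \<Rightarrow> ('a \<Rightarrow> int) \<Rightarrow> (int list \<times> 'a) sset" where
  "twisted_product d Y \<gamma> = \<lparr>
    simplices = (\<lambda>n. simplices (nerve d) n \<times> simplices Y n),
    face = (\<lambda>n i (\<alpha>, \<tau>).
      (if i = 0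
       then map2 (\<lambda>a b. a \<otimes>\<^bsub>integer_mod_group d\<^esub> b) (twisting d Y \<gamma> n \<tau>) (face (nerve d) n 0 \<alpha>)
       else face (nerve d) n i \<alpha>,
       face Y n i \<tau>)),
    degen = (\<lambda>n j (\<alpha>, \<tau>). (degen (nerve d) n j \<alpha>, degen Y n j \<tau>))\<rparr>"


section \<open>Groups given by generators and relations\<close>

text \<open>
  Words over \<open>S\<close> are lists of letters \<open>(b, s)\<close> with \<open>s \<in> S\<close>, where \<open>(True, s)\<close> stands for \<open>s\<close> and
  \<open>(False, s)\<close> for its formal inverse.
\<close>

abbreviation words :: "'g set \<Rightarrow> (bool \<times> 'g) list set" where
  "words S \<equiv> lists (UNIV \<times> S)"

inductive_set free_rel :: "'g set \<Rightarrow> ((bool \<times> 'g) list \<times> (bool \<times> 'g) list) set"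
  for S :: "'g set" where
  refl: "u \<in> words S \<Longrightarrow> (u, u) \<in> free_rel S"
| sym: "(u, v) \<in> free_rel S \<Longrightarrow> (v, u) \<in> free_rel S"
| trans: "(u, v) \<in> free_rel S \<Longrightarrow> (v, w) \<in> free_rel S \<Longrightarrow> (u, w) \<in> free_rel S"
| cancel: "u \<in> words S \<Longrightarrow> v \<in> words S \<Longrightarrow> s \<in> S \<Longrightarrow>
    (u @ [(b, s), (\<not> b, s)] @ v, u @ v) \<in> free_rel S"

definition free_group :: "'g set \<Rightarrow> (bool \<times> 'g) list set monoid" where
  "free_group S = \<lparr>
    carrier = words S // free_rel S,
    monoid.mult = (\<lambda>A B. \<Union>u\<in>A. \<Union>v\<in>B. free_rel S `` {u @ v}),
    one = free_rel S `` {[]}\<rparr>"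

definition free_gen :: "'g set \<Rightarrow> 'g \<Rightarrow> (bool \<times> 'g) list set" where
  "free_gen S s = free_rel S `` {[(True, s)]}"

definition normal_closure :: "('a, 'b) monoid_scheme \<Rightarrow> 'a set \<Rightarrow> 'a set" where
  "normal_closure G R = \<Inter>{N. N \<lhd> G \<and> R \<subseteq> N}"

definition commutator :: "('a, 'b) monoid_scheme \<Rightarrow> 'a \<Rightarrow> 'a \<Rightarrow> 'a" where
  "commutator G g h = g \<otimes>\<^bsub>G\<^esub> h \<otimes>\<^bsub>G\<^esub> inv\<^bsub>G\<^esub> g \<otimes>\<^bsub>G\<^esub> inv\<^bsub>G\<^esub> h"

text \<open>The relators \<open>R\<close> are elements of the free group on \<open>S\<close>.\<close>

definition presented_group ::
  "'g set \<Rightarrow> (bool \<times> 'g) list set set \<Rightarrow> (bool \<times> 'g) list set set monoid" where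
  "presented_group S R = free_group S Mod normal_closure (free_group S) R"

definition presented_gen ::
  "'g set \<Rightarrow> (bool \<times> 'g) list set set \<Rightarrow> 'g \<Rightarrow> (bool \<times> 'g) list set set" where
  "presented_gen S R s = normal_closure (free_group S) R #>\<^bsub>free_group S\<^esub> free_gen S s"

lemma free_rel_words: "(u, v) \<in> free_rel S \<Longrightarrow> u \<in> words S \<and> v \<in> words S"
  by (induction rule: free_rel.induct) auto

lemma equiv_free_rel: "equiv (words S) (free_rel S)"
  by (rule equivI)
    (auto simp: refl_on_def dest: free_rel_words intro: free_rel.refl
      intro!: symI transI intro: free_rel.sym free_rel.trans)

lemma free_rel_append_left:
  "(u, v) \<in> free_rel S \<Longrightarrow> w \<in> words S \<Longrightarrow> (w @ u, w @ v) \<in> free_rel S"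
proof (induction rule: free_rel.induct)
  case (cancel u v s b)
  then show ?case
    using free_rel.cancel[of "w @ u" S v s b] by simp
qed (simp_all only: free_rel.refl append_in_lists_conv simp_thms,
    (blast intro: free_rel.sym free_rel.trans)+)

lemma free_rel_append_right:
  "(u, v) \<in> free_rel S \<Longrightarrow> w \<in> words S \<Longrightarrow> (u @ w, v @ w) \<in> free_rel S"
proof (induction rule: free_rel.induct)
  case (cancel u v s b)
  then show ?case
    using free_rel.cancel[of u S "v @ w" s b] by simp
qed (simp_all only: free_rel.refl append_in_lists_conv simp_thms,
    (blast intro: free_rel.sym free_rel.trans)+)

lemma free_rel_append:
  "(u, u') \<in> free_rel S \<Longrightarrow> (v, v') \<in> free_rel S \<Longrightarrow> (u @ v, u' @ v') \<in> free_rel S"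
  by (meson free_rel.trans free_rel_append_left free_rel_append_right free_rel_words)

lemma free_group_mult:
  assumes "u \<in> words S" "v \<in> words S"
  shows "(free_rel S `` {u}) \<otimes>\<^bsub>free_group S\<^esub> (free_rel S `` {v}) = free_rel S `` {u @ v}"
proof -
  have "congruent2 (free_rel S) (free_rel S) (\<lambda>u v. free_rel S `` {u @ v})"
    by (rule congruent2I[OF equiv_free_rel equiv_free_rel])
      (auto intro!: equiv_class_eq[OF equiv_free_rel] intro: free_rel_append free_rel.refl)
  from UN_equiv_class2[OF equiv_free_rel equiv_free_rel this assms]
  show ?thesis by (simp add: free_group_def)
qed

lemma free_rel_inverse:
  "u \<in> words S \<Longrightarrow> (map (\<lambda>(b, s). (\<not> b, s)) (rev u) @ u, []) \<in> free_rel S"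
proof (induction u)
  case (Cons l u)
  obtain b s where l: "l = (b, s)" by force
  let ?i = "map (\<lambda>(b, s). (\<not> b, s)) (rev u)"
  have "?i \<in> words S" "u \<in> words S" "s \<in> S" using Cons.prems l by auto
  then have "(?i @ [(\<not> b, s), (\<not> \<not> b, s)] @ u, ?i @ u) \<in> free_rel S"
    by (intro free_rel.cancel)
  with Cons l show ?case by (auto intro: free_rel.trans)
qed (auto intro: free_rel.refl)

lemma group_free_group: "group (free_group S)"
proof (rule groupI)
  let ?c = "\<lambda>u. free_rel S `` {u}"
  have car: "x \<in> carrier (free_group S) \<longleftrightarrow> (\<exists>u\<in>words S. x = ?c u)" for x
    by (auto simp: free_group_def quotient_def)
  have one: "\<one>\<^bsub>free_group S\<^esub> = ?c []" by (simp add: free_group_def)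
  show "\<one>\<^bsub>free_group S\<^esub> \<in> carrier (free_group S)"
    unfolding car one by blast
  fix x y z assume x: "x \<in> carrier (free_group S)"
  then obtain u where u: "u \<in> words S" "x = ?c u" using car by auto
  show "\<one>\<^bsub>free_group S\<^esub> \<otimes>\<^bsub>free_group S\<^esub> x = x"
    using free_group_mult[of "[]" S u] u by (simp add: one)
  let ?i = "map (\<lambda>(b, s). (\<not> b, s)) (rev u)"
  have i: "?i \<in> words S" using u(1) by auto
  have "?c ?i \<otimes>\<^bsub>free_group S\<^esub> x = \<one>\<^bsub>free_group S\<^esub>"
    unfolding one u(2) free_group_mult[OF i u(1)]
    using equiv_class_eq[OF equiv_free_rel free_rel_inverse[OF u(1)]] .
  then show "\<exists>y\<in>carrier (free_group S). y \<otimes>\<^bsub>free_group S\<^esub> x = \<one>\<^bsub>free_group S\<^esub>"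
    using i car by blast
  assume "y \<in> carrier (free_group S)"
  then obtain v where v: "v \<in> words S" "y = ?c v" using car by auto
  have uv: "u @ v \<in> words S" using u v by auto
  show "x \<otimes>\<^bsub>free_group S\<^esub> y \<in> carrier (free_group S)"
    unfolding car u(2) v(2) free_group_mult[OF u(1) v(1)] using uv by blast
  assume "z \<in> carrier (free_group S)"
  then obtain w where w: "w \<in> words S" "z = ?c w" using car by auto
  have vw: "v @ w \<in> words S" using v w by auto
  show "x \<otimes>\<^bsub>free_group S\<^esub> y \<otimes>\<^bsub>free_group S\<^esub> z =
      x \<otimes>\<^bsub>free_group S\<^esub> (y \<otimes>\<^bsub>free_group S\<^esub> z)"
    using free_group_mult[OF u(1) v(1)] free_group_mult[OF uv w(1)]
      free_group_mult[OF v(1) w(1)] free_group_mult[OF u(1) vw] u v w by simp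
qed

lemma free_gen_closed: "s \<in> S \<Longrightarrow> free_gen S s \<in> carrier (free_group S)"
  by (auto simp: free_gen_def free_group_def intro!: quotientI)

lemma normal_normal_closure:
  assumes "group G" "R \<subseteq> carrier G"
  shows "normal_closure G R \<lhd> G"
proof -
  interpret group G by fact
  have ne: "carrier G \<in> {N. N \<lhd> G \<and> R \<subseteq> N}"
    using assms(2) by (auto intro!: normal_invI subgroup_self)
  show ?thesis unfolding normal_closure_def
  proof (rule normal_invI)
    show "subgroup (\<Inter>{N. N \<lhd> G \<and> R \<subseteq> N}) G"
      using ne by (intro subgroups_Inter) (auto simp: normal_imp_subgroup)
  qed (auto simp: normal.inv_op_closed2)
qed

lemma group_presented_group:
  "R \<subseteq> carrier (free_group S) \<Longrightarrow> group (presented_group S R)"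
  unfolding presented_group_def
  by (intro normal.factorgroup_is_group normal_normal_closure group_free_group)


section \<open>The group \<open>\<pi>\<^sub>1(\<int>\<^sub>d, Y)\<close>\<close>

definition pi1_relators :: "nat \<Rightarrow> 'a sset \<Rightarrow> (bool \<times> 'a) list set set" where
  "pi1_relators d Y =
    (let F = free_group (simplices Y 1); e = free_gen (simplices Y 1) in
      {e y [^]\<^bsub>F\<^esub> d | y. y \<in> simplices Y 1} \<union>
      {commutator F (e (face Y 2 i \<sigma>)) (e (face Y 2 j \<sigma>)) | \<sigma> i j.
        \<sigma> \<in> simplices Y 2 \<and> i \<le> 2 \<and> j \<le> 2} \<union>
      {e (face Y 2 2 \<sigma>) \<otimes>\<^bsub>F\<^esub> e (face Y 2 0 \<sigma>) \<otimes>\<^bsub>F\<^esub> inv\<^bsub>F\<^esub> e (face Y 2 1 \<sigma>) | \<sigma>.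
        \<sigma> \<in> simplices Y 2})"

definition pi1 :: "nat \<Rightarrow> 'a sset \<Rightarrow> (bool \<times> 'a) list set set monoid" where
  "pi1 d Y = presented_group (simplices Y 1) (pi1_relators d Y)"

definition pi1_gen :: "nat \<Rightarrow> 'a sset \<Rightarrow> 'a \<Rightarrow> (bool \<times> 'a) list set set" where
  "pi1_gen d Y = presented_gen (simplices Y 1) (pi1_relators d Y)"


section \<open>Linear systems and solution groups\<close>

datatype 'c solution_sym = SymJ | SymE 'c

definition solution_syms :: "'c set \<Rightarrow> 'c solution_sym set" where
  "solution_syms C = insert SymJ (SymE ` C)"

text \<open>
  The linear system has rows \<open>R\<close>, columns \<open>C\<close> and entries \<open>A r c\<close>, \<open>b r\<close> in \<open>{0..<d}\<close>. As the
  generators in the support of a row commute, the order in the product over this support is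
  irrelevant; the relator is imposed for every enumeration of the support.
\<close>

definition solution_relators ::
  "nat \<Rightarrow> 'r set \<Rightarrow> 'c set \<Rightarrow> ('r \<Rightarrow> 'c \<Rightarrow> int) \<Rightarrow> ('r \<Rightarrow> int) \<Rightarrow>
    (bool \<times> 'c solution_sym) list set set" where
  "solution_relators d R C A b =
    (let F = free_group (solution_syms C);
         J = free_gen (solution_syms C) SymJ;
         e = (\<lambda>c. free_gen (solution_syms C) (SymE c)) in
      {J [^]\<^bsub>F\<^esub> d} \<union>
      {e c [^]\<^bsub>F\<^esub> d | c. c \<in> C} \<union>
      {commutator F J (e c) | c. c \<in> C} \<union>
      {commutator F (e c) (e c') | r c c'.
        r \<in> R \<and> c \<in> C \<and> c' \<in> C \<and> A r c \<noteq> 0 \<and> A r c' \<noteq> 0} \<union>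
      {foldr (\<lambda>c g. (e c [^]\<^bsub>F\<^esub> A r c) \<otimes>\<^bsub>F\<^esub> g) cs \<one>\<^bsub>F\<^esub> \<otimes>\<^bsub>F\<^esub> inv\<^bsub>F\<^esub> (J [^]\<^bsub>F\<^esub> b r) | r cs.
        r \<in> R \<and> distinct cs \<and> set cs = {c \<in> C. A r c \<noteq> 0}})"

definition solution_group ::
  "nat \<Rightarrow> 'r set \<Rightarrow> 'c set \<Rightarrow> ('r \<Rightarrow> 'c \<Rightarrow> int) \<Rightarrow> ('r \<Rightarrow> int) \<Rightarrow>
    (bool \<times> 'c solution_sym) list set set monoid" where
  "solution_group d R C A b = presented_group (solution_syms C) (solution_relators d R C A b)"

definition solution_gen ::
  "nat \<Rightarrow> 'r set \<Rightarrow> 'c set \<Rightarrow> ('r \<Rightarrow> 'c \<Rightarrow> int) \<Rightarrow> ('r \<Rightarrow> int) \<Rightarrow>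
    'c solution_sym \<Rightarrow> (bool \<times> 'c solution_sym) list set set" where
  "solution_gen d R C A b = presented_gen (solution_syms C) (solution_relators d R C A b)"

definition sset_matrix :: "nat \<Rightarrow> 'a sset \<Rightarrow> 'a \<Rightarrow> 'a \<Rightarrow> int" where
  "sset_matrix d Y \<sigma> x = (\<Sum>i\<in>{i. i \<le> 2 \<and> face Y 2 i \<sigma> = x}. (-1) ^ i) mod int d"

definition sset_vector :: "nat \<Rightarrow> ('a \<Rightarrow> int) \<Rightarrow> 'a \<Rightarrow> int" where
  "sset_vector d \<gamma> \<sigma> = (- \<gamma> \<sigma>) mod int d"

definition Gamma :: "nat \<Rightarrow> 'a sset \<Rightarrow> ('a \<Rightarrow> int) \<Rightarrow> (bool \<times> 'a solution_sym) list set set monoid"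
  where "Gamma d Y \<gamma> =
    solution_group d (simplices Y 2) (simplices Y 1) (sset_matrix d Y) (sset_vector d \<gamma>)"

definition Gamma_gen ::
  "nat \<Rightarrow> 'a sset \<Rightarrow> ('a \<Rightarrow> int) \<Rightarrow> 'a solution_sym \<Rightarrow> (bool \<times> 'a solution_sym) list set set"
  where "Gamma_gen d Y \<gamma> =
    solution_gen d (simplices Y 2) (simplices Y 1) (sset_matrix d Y) (sset_vector d \<gamma>)"

end

theory Submission
  imports Defs
begin

text \<open>
  Both groups are given by generators and relations, so the isomorphism is a matter of translating
  relations in both directions.

  The relations of the solution group first have to be brought into the shape of those of
  \<open>\<pi>\<^sub>1\<close>. If a triangle \<open>\<sigma>\<close> has repeated faces, coefficients of its row may vanish, and the solution
  group says nothing about commutation of the lost face. But then the row consists of one single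
  entry \<open>1\<close>, which puts the remaining generator into the powers of the central element \<open>J\<close>. Hence in
  all cases the relations say: the generators on the faces of \<open>\<sigma>\<close> commute, and
  \<open>J\<^bsup>\<gamma>(\<sigma>)\<^esup> e\<^bsub>d\<^sub>2\<sigma>\<^esub> e\<^bsub>d\<^sub>0\<sigma>\<^esub> = e\<^bsub>d\<^sub>1\<sigma>\<^esub>\<close> (\<open>linear_solution_iff_twisted_solution\<close>).

  From such elements, \<open>e\<^bsub>a,x\<^esub> = J\<^sup>a e\<^sub>x\<close> satisfies the relations of the twisted product, because the
  twist adds \<open>\<gamma>(\<sigma>)\<close> to the label of \<open>d\<^sub>0\<close> (\<open>pi1_solution_twisted_product\<close>). Conversely, among
  elements \<open>e\<^bsub>a,x\<^esub>\<close> satisfying the relations of the twisted product, those over degenerate edges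
  \<open>s\<^sub>0 v\<close> are recovered as the powers of \<open>J\<close>. Normalization of the cocycle makes the triangles over
  \<open>s\<^sub>0 x\<close> and \<open>s\<^sub>1 x\<close> untwisted, and these show that the elements over \<open>s\<^sub>0 v\<close> are the same at both
  ends \<open>v\<close> of \<open>x\<close>, additive in the label, and commute with the elements over \<open>x\<close>. By connectedness they
  are independent of \<open>v\<close> (\<open>twisted_solution_of_pi1_solution\<close>). The two constructions are
  inverse on generators, since the triangle \<open>s\<^sub>0 s\<^sub>0 v\<close> forces \<open>e\<^bsub>s\<^sub>0v\<^esub> = 1\<close> in the solution group.

  If \<open>\<gamma>'\<close> is \<open>\<gamma>\<close> plus the coboundary of a \<open>1\<close>-cochain \<open>k\<close>, then \<open>e\<^sub>x \<mapsto> J\<^bsup>k(x)\<^esup> e\<^sub>x\<close> respects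
  the relations of the solution group of \<open>\<gamma>\<close> when the right-hand side is read in that of \<open>\<gamma>'\<close>, and
  \<open>- k\<close> gives the inverse (\<open>twisted_solution_shift\<close>).
\<close>

section \<open>Homomorphisms out of a presented group\<close>

definition eval_word :: "('b, 'c) monoid_scheme \<Rightarrow> ('g \<Rightarrow> 'b) \<Rightarrow> (bool \<times> 'g) list \<Rightarrow> 'b" where
  "eval_word G \<phi> w =
    foldr (\<lambda>(b, s) g. (if b then \<phi> s else inv\<^bsub>G\<^esub> \<phi> s) \<otimes>\<^bsub>G\<^esub> g) w \<one>\<^bsub>G\<^esub>"

context group
begin

lemma eval_word_closed:
  "\<phi> \<in> S \<rightarrow> carrier G \<Longrightarrow> w \<in> words S \<Longrightarrow> eval_word G \<phi> w \<in> carrier G"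
  by (induction w) (auto simp: eval_word_def Pi_iff)

lemma eval_word_append:
  assumes "\<phi> \<in> S \<rightarrow> carrier G" "u \<in> words S" "v \<in> words S"
  shows "eval_word G \<phi> (u @ v) = eval_word G \<phi> u \<otimes> eval_word G \<phi> v"
  using assms(2)
proof (induction u)
  case Nil
  then show ?case using eval_word_closed[OF assms(1,3)] by (simp add: eval_word_def)
next
  case (Cons l u)
  obtain b s where l: "l = (b, s)" by force
  have u: "u \<in> words S" and s: "\<phi> s \<in> carrier G" using Cons.hyps assms(1) l by auto
  from Cons.IH show ?case
    using s eval_word_closed[OF assms(1) u] eval_word_closed[OF assms(1,3)]
    by (simp add: eval_word_def l m_assoc)
qed

lemma eval_word_free_rel:
  assumes "(u, v) \<in> free_rel S" and \<phi>: "\<phi> \<in> S \<rightarrow> carrier G"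
  shows "eval_word G \<phi> u = eval_word G \<phi> v"
  using assms(1)
proof (induction rule: free_rel.induct)
  case (cancel u v s b)
  then have s: "\<phi> s \<in> carrier G" using \<phi> by auto
  have "eval_word G \<phi> ([(b, s), (\<not> b, s)] @ v) = eval_word G \<phi> v"
    using s eval_word_closed[OF \<phi> cancel(2)]
    by (auto simp: eval_word_def m_assoc[symmetric])
  moreover have "[(b, s), (\<not> b, s)] @ v \<in> words S" using cancel by auto
  ultimately show ?case
    using cancel by (simp only: eval_word_append[OF \<phi>])
qed auto

end

lemma carrier_free_group: "carrier (free_group S) = (\<lambda>u. free_rel S `` {u}) ` words S"
  by (auto simp: free_group_def quotient_def)

text \<open>
  The extension of \<open>\<phi>\<close> evaluates an arbitrary representative of a class of words; the value does not
  depend on the representative since evaluation cannot see the cancellation of \<open>s s\<inverse>\<close>.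
\<close>

lemma free_group_universal:
  assumes "group G" and \<phi>: "\<phi> \<in> S \<rightarrow> carrier G"
  obtains F where "F \<in> hom (free_group S) G" "\<And>s. s \<in> S \<Longrightarrow> F (free_gen S s) = \<phi> s"
proof -
  interpret group G by fact
  define F where "F A = eval_word G \<phi> (SOME u. u \<in> A)" for A
  have F: "F (free_rel S `` {u}) = eval_word G \<phi> u" if "u \<in> words S" for u
  proof -
    have "u \<in> free_rel S `` {u}" using that by (auto intro: free_rel.refl)
    then have "(u, SOME u'. u' \<in> free_rel S `` {u}) \<in> free_rel S"
      by (metis Image_singleton_iff someI)
    from eval_word_free_rel[OF this \<phi>] show ?thesis by (simp add: F_def)
  qed
  show thesis
  proof (rule that[of F])
    show "F \<in> hom (free_group S) G"
    proof (rule homI)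
      fix x assume "x \<in> carrier (free_group S)"
      then obtain u where u: "u \<in> words S" "x = free_rel S `` {u}"
        by (auto simp: carrier_free_group)
      then show "F x \<in> carrier G" by (simp only: F eval_word_closed[OF \<phi>])
      fix y assume "y \<in> carrier (free_group S)"
      then obtain v where v: "v \<in> words S" "y = free_rel S `` {v}"
        by (auto simp: carrier_free_group)
      have uv: "u @ v \<in> words S" using u v by auto
      show "F (x \<otimes>\<^bsub>free_group S\<^esub> y) = F x \<otimes>\<^bsub>G\<^esub> F y"
        using u v by (simp only: free_group_mult F[OF uv] F eval_word_append[OF \<phi>])
    qed
    fix s assume "s \<in> S"
    then have "[(True, s)] \<in> words S" "\<phi> s \<in> carrier G" using \<phi> by auto
    then show "F (free_gen S s) = \<phi> s"
      by (simp only: free_gen_def F) (simp add: eval_word_def)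
  qed
qed

lemma free_group_hom_eqI:
  assumes "group G" "F \<in> hom (free_group S) G" "F' \<in> hom (free_group S) G"
    and eq: "\<And>s. s \<in> S \<Longrightarrow> F (free_gen S s) = F' (free_gen S s)"
    and "x \<in> carrier (free_group S)"
  shows "F x = F' x"
proof -
  interpret W: group "free_group S" by (rule group_free_group)
  interpret F: group_hom "free_group S" G F
    using assms by (intro group_hom.intro group_hom_axioms.intro group_free_group)
  interpret F': group_hom "free_group S" G F'
    using assms by (intro group_hom.intro group_hom_axioms.intro group_free_group)
  have letter: "F (free_rel S `` {[l]}) = F' (free_rel S `` {[l]})" if l_in: "l \<in> UNIV \<times> S" for l
  proof -
    obtain b s where l: "l = (b, s)" and s: "s \<in> S" using l_in by auto
    show ?thesis
    proof (cases b)
      case True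
      then show ?thesis using eq[OF s] by (simp add: l free_gen_def)
    next
      case False
      have w: "[(False, s)] \<in> words S" "[(True, s)] \<in> words S" using s by auto
      have "([] @ [(False, s), (\<not> False, s)] @ [], [] @ []) \<in> free_rel S"
        using s by (intro free_rel.cancel) auto
      then have "free_rel S `` {[(False, s)]} \<otimes>\<^bsub>free_group S\<^esub> free_gen S s = \<one>\<^bsub>free_group S\<^esub>"
        unfolding free_gen_def free_group_mult[OF w]
        by (simp add: equiv_class_eq[OF equiv_free_rel] free_group_def)
      then have "free_rel S `` {[(False, s)]} = inv\<^bsub>free_group S\<^esub> free_gen S s"
        using w s by (intro W.inv_equality[symmetric] free_gen_closed) (auto simp: carrier_free_group)
      then show ?thesis using False s eq[OF s]
        by (simp add: l F.hom_inv F'.hom_inv free_gen_closed)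
    qed
  qed
  obtain u where u: "u \<in> words S" "x = free_rel S `` {u}"
    using assms(5) by (auto simp: carrier_free_group)
  from u(1) have "F (free_rel S `` {u}) = F' (free_rel S `` {u})"
  proof (induction u)
    case Nil
    have "free_rel S `` {[]} = \<one>\<^bsub>free_group S\<^esub>" by (simp add: free_group_def)
    then show ?case by simp
  next
    case (Cons l u)
    then have l: "[l] \<in> words S" and u: "u \<in> words S" by auto
    have "free_rel S `` {l # u} = free_rel S `` {[l]} \<otimes>\<^bsub>free_group S\<^esub> free_rel S `` {u}"
      using free_group_mult[OF l u] by simp
    moreover have "free_rel S `` {[l]} \<in> carrier (free_group S)"
        "free_rel S `` {u} \<in> carrier (free_group S)"
      unfolding carrier_free_group by (rule imageI[OF l], rule imageI[OF u])
    ultimately show ?case using letter[OF Cons.hyps(1)] Cons.IH by simp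
  qed
  then show ?thesis using u(2) by simp
qed

definition presented_proj ::
  "'g set \<Rightarrow> (bool \<times> 'g) list set set \<Rightarrow> (bool \<times> 'g) list set \<Rightarrow> (bool \<times> 'g) list set set" where
  "presented_proj S R w = normal_closure (free_group S) R #>\<^bsub>free_group S\<^esub> w"

context
  fixes S :: "'g set" and R :: "(bool \<times> 'g) list set set"
  assumes relators: "R \<subseteq> carrier (free_group S)"
begin

lemma presented_proj_hom:
  "presented_proj S R \<in> hom (free_group S) (presented_group S R)"
  unfolding presented_proj_def presented_group_def
  by (intro normal.r_coset_hom_Mod normal_normal_closure group_free_group relators)

lemma presented_proj_onto:
  "presented_proj S R ` carrier (free_group S) = carrier (presented_group S R)"
  by (simp add: presented_proj_def presented_group_def carrier_FactGroup)

lemma presented_proj_gen: "presented_proj S R (free_gen S s) = presented_gen S R s"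
  by (simp add: presented_proj_def presented_gen_def)

lemma presented_proj_relators: "presented_proj S R ` R \<subseteq> {\<one>\<^bsub>presented_group S R\<^esub>}"
proof -
  interpret normal "normal_closure (free_group S) R" "free_group S"
    by (rule normal_normal_closure[OF group_free_group relators])
  have "R \<subseteq> normal_closure (free_group S) R" by (auto simp: normal_closure_def)
  then show ?thesis
    using rcos_const by (auto simp: presented_group_def presented_proj_def)
qed

text \<open>
  Von Dyck's theorem. The condition on the relators is phrased through homomorphisms \<open>F\<close> of the free
  group because the relators are elements of it, not words: on a concrete relator the homomorphism
  laws turn \<open>F r = \<one>\<close> into an equation between the images of the generators.
\<close>

lemma presented_group_universal:
  assumes "group G" "\<phi> \<in> S \<rightarrow> carrier G"
    and kill: "\<And>F. F \<in> hom (free_group S) G \<Longrightarrow> (\<And>s. s \<in> S \<Longrightarrow> F (free_gen S s) = \<phi> s) \<Longrightarrow>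
      F ` R \<subseteq> {\<one>\<^bsub>G\<^esub>}"
  obtains h where "h \<in> hom (presented_group S R) G"
    "\<And>s. s \<in> S \<Longrightarrow> h (presented_gen S R s) = \<phi> s"
proof -
  obtain F where F: "F \<in> hom (free_group S) G" "\<And>s. s \<in> S \<Longrightarrow> F (free_gen S s) = \<phi> s"
    using free_group_universal[OF assms(1,2)] by blast
  interpret group_hom "free_group S" G F
    using F assms(1) by (intro group_hom.intro group_hom_axioms.intro group_free_group)
  have "R \<subseteq> kernel (free_group S) G F" using kill[OF F] relators by (auto simp: kernel_def)
  then have "normal_closure (free_group S) R \<subseteq> kernel (free_group S) G F"
    using normal_kernel by (auto simp: normal_closure_def)
  from FactGroup_universal_kernel[OF normal_normal_closure[OF group_free_group relators] this]
  obtain h where "h \<in> hom (presented_group S R) G" "\<And>x. x \<in> carrier (free_group S) \<Longrightarrow>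
      h (normal_closure (free_group S) R #>\<^bsub>free_group S\<^esub> x) = F x"
    unfolding presented_group_def by blast
  then show thesis using F(2) by (intro that) (auto simp: presented_gen_def free_gen_closed)
qed

lemma presented_group_hom_eqI:
  assumes "group G" "f \<in> hom (presented_group S R) G" "g \<in> hom (presented_group S R) G"
    and "\<And>s. s \<in> S \<Longrightarrow> f (presented_gen S R s) = g (presented_gen S R s)"
    and "x \<in> carrier (presented_group S R)"
  shows "f x = g x"
proof -
  let ?q = "presented_proj S R"
  obtain w where w: "w \<in> carrier (free_group S)" "x = ?q w"
    using presented_proj_onto assms(5) by auto
  have "(f \<circ> ?q) w = (g \<circ> ?q) w"
    by (rule free_group_hom_eqI[OF assms(1) hom_compose[OF presented_proj_hom assms(2)]
          hom_compose[OF presented_proj_hom assms(3)] _ w(1)])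
      (simp add: presented_proj_gen assms(4))
  then show ?thesis using w by simp
qed

end

text \<open>
  Homomorphisms out of a presented group are determined on generators, so mutually inverse
  assignments of generators suffice for an isomorphism.
\<close>

lemma presented_group_isoI:
  assumes R: "R \<subseteq> carrier (free_group S)" and R': "R' \<subseteq> carrier (free_group S')"
    and f: "f \<in> hom (presented_group S R) (presented_group S' R')"
    and g: "g \<in> hom (presented_group S' R') (presented_group S R)"
    and gf: "\<And>s. s \<in> S \<Longrightarrow> g (f (presented_gen S R s)) = presented_gen S R s"
    and fg: "\<And>s. s \<in> S' \<Longrightarrow> f (g (presented_gen S' R' s)) = presented_gen S' R' s"
  shows "f \<in> iso (presented_group S R) (presented_group S' R')"
proof -
  have "(g \<circ> f) x = (\<lambda>x. x) x" if "x \<in> carrier (presented_group S R)" for x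
    by (rule presented_group_hom_eqI[OF R group_presented_group[OF R] hom_compose[OF f g] _ _ that])
      (simp_all add: gf hom_def)
  moreover have "(f \<circ> g) x = (\<lambda>x. x) x" if "x \<in> carrier (presented_group S' R')" for x
    by (rule presented_group_hom_eqI[OF R' group_presented_group[OF R'] hom_compose[OF g f] _ _ that])
      (simp_all add: fg hom_def)
  ultimately have "bij_betw f (carrier (presented_group S R)) (carrier (presented_group S' R'))"
    using hom_in_carrier[OF f] hom_in_carrier[OF g]
    by (intro bij_betw_byWitness[where f' = g]) auto
  then show ?thesis using f by (simp add: iso_def)
qed


section \<open>Commuting elements\<close>

context group
begin

lemma mult_inv_eq_one_iff:
  assumes "g \<in> carrier G" "h \<in> carrier G"
  shows "g \<otimes> inv h = \<one> \<longleftrightarrow> g = h"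
  using assms by (metis inv_closed inv_equality inv_inv r_inv)

lemma commutator_eq_one_iff:
  assumes "g \<in> carrier G" "h \<in> carrier G"
  shows "commutator G g h = \<one> \<longleftrightarrow> g \<otimes> h = h \<otimes> g"
proof -
  have "commutator G g h = (g \<otimes> h) \<otimes> inv (h \<otimes> g)"
    using assms by (simp add: commutator_def inv_mult_group m_assoc)
  then show ?thesis using assms by (simp add: mult_inv_eq_one_iff)
qed

text \<open>
  Commutation with \<open>g\<close> passes to all powers and products because it cuts out a subgroup.
\<close>

lemma centralizer_subgroup:
  assumes "g \<in> carrier G"
  shows "subgroup {h \<in> carrier G. g \<otimes> h = h \<otimes> g} G"
proof (rule subgroupI)
  fix h assume "h \<in> {h \<in> carrier G. g \<otimes> h = h \<otimes> g}"
  then have h: "h \<in> carrier G" "g \<otimes> h = h \<otimes> g" by auto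
  then have "inv h \<otimes> (g \<otimes> h) \<otimes> inv h = inv h \<otimes> (h \<otimes> g) \<otimes> inv h" by simp
  also have "inv h \<otimes> (g \<otimes> h) \<otimes> inv h = inv h \<otimes> g \<otimes> (h \<otimes> inv h)"
    using h(1) assms by (simp only: m_assoc m_closed inv_closed)
  also have "inv h \<otimes> (h \<otimes> g) \<otimes> inv h = inv h \<otimes> h \<otimes> g \<otimes> inv h"
    using h(1) assms by (simp only: m_assoc m_closed inv_closed)
  finally have "inv h \<otimes> g = g \<otimes> inv h" using h(1) assms by simp
  then show "inv h \<in> {h \<in> carrier G. g \<otimes> h = h \<otimes> g}" using h by auto
next
  fix h k assume "h \<in> {h \<in> carrier G. g \<otimes> h = h \<otimes> g}" "k \<in> {h \<in> carrier G. g \<otimes> h = h \<otimes> g}"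
  then show "h \<otimes> k \<in> {h \<in> carrier G. g \<otimes> h = h \<otimes> g}"
    using assms by auto (metis m_assoc)
qed (use assms in auto)

lemma commute_int_pow:
  assumes "g \<in> carrier G" "h \<in> carrier G" "g \<otimes> h = h \<otimes> g"
  shows "g \<otimes> h [^] (k::int) = h [^] k \<otimes> g"
  using subgroup_int_pow_closed[OF centralizer_subgroup[OF assms(1)], of h k] assms by auto

lemma int_pow_mod:
  assumes "g \<in> carrier G" "g [^] (d::nat) = \<one>"
  shows "g [^] (k mod int d) = g [^] (k::int)"
proof -
  have "g [^] (int d * (k div int d)) = \<one>"
    using assms by (simp add: int_pow_pow[symmetric] int_pow_int)
  moreover have "g [^] k = g [^] (int d * (k div int d)) \<otimes> g [^] (k mod int d)"
    using assms(1) by (simp add: int_pow_mult[symmetric])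
  ultimately show ?thesis using assms(1) by simp
qed

end


section \<open>Presentations as systems of equations\<close>

text \<open>
  Edges live in dimension \<open>1\<close>. Rewriting this to \<open>Suc 0\<close> would separate goals from facts about
  \<open>simplices Y 1\<close> that an interpreted locale supplies.
\<close>

declare One_nat_def [simp del]

lemma (in group_hom) hom_commutator:
  "g \<in> carrier G \<Longrightarrow> k \<in> carrier G \<Longrightarrow> h (commutator G g k) = commutator H (h g) (h k)"
  by (simp add: commutator_def)

lemma (in group_hom) hom_foldr_int_pow:
  fixes A :: "'e \<Rightarrow> int"
  assumes "\<And>c. c \<in> set cs \<Longrightarrow> e c \<in> carrier G"
  shows "h (foldr (\<lambda>c g. (e c [^]\<^bsub>G\<^esub> A c) \<otimes>\<^bsub>G\<^esub> g) cs \<one>\<^bsub>G\<^esub>) =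
    foldr (\<lambda>c g. (h (e c) [^]\<^bsub>H\<^esub> A c) \<otimes>\<^bsub>H\<^esub> g) cs \<one>\<^bsub>H\<^esub>"
proof -
  have "foldr (\<lambda>c g. (e c [^]\<^bsub>G\<^esub> A c) \<otimes>\<^bsub>G\<^esub> g) cs \<one>\<^bsub>G\<^esub> \<in> carrier G \<and>
    h (foldr (\<lambda>c g. (e c [^]\<^bsub>G\<^esub> A c) \<otimes>\<^bsub>G\<^esub> g) cs \<one>\<^bsub>G\<^esub>) =
    foldr (\<lambda>c g. (h (e c) [^]\<^bsub>H\<^esub> A c) \<otimes>\<^bsub>H\<^esub> g) cs \<one>\<^bsub>H\<^esub>"
    using assms by (induction cs) (simp_all add: hom_int_pow)
  then show ?thesis by simp
qed

text \<open>
  A homomorphism from a presented group to \<open>G\<close> is a family of elements of \<open>G\<close> satisfying the defining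
  relations. The two predicates below say this for \<open>\<pi>\<^sub>1(\<int>\<^sub>d, Y)\<close> and for a solution group; from here
  on homomorphisms are built and compared only through such families.
\<close>

definition pi1_solution ::
  "nat \<Rightarrow> 'a sset \<Rightarrow> ('b, 'c) monoid_scheme \<Rightarrow> ('a \<Rightarrow> 'b) \<Rightarrow> bool" where
  "pi1_solution d Y G e \<longleftrightarrow>
    (\<forall>y\<in>simplices Y 1. e y \<in> carrier G \<and> e y [^]\<^bsub>G\<^esub> d = \<one>\<^bsub>G\<^esub>) \<and>
    (\<forall>\<sigma>\<in>simplices Y 2.
      (\<forall>i\<le>2. \<forall>j\<le>2. e (face Y 2 i \<sigma>) \<otimes>\<^bsub>G\<^esub> e (face Y 2 j \<sigma>) =
        e (face Y 2 j \<sigma>) \<otimes>\<^bsub>G\<^esub> e (face Y 2 i \<sigma>)) \<and>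
      e (face Y 2 2 \<sigma>) \<otimes>\<^bsub>G\<^esub> e (face Y 2 0 \<sigma>) = e (face Y 2 1 \<sigma>))"

definition linear_solution ::
  "nat \<Rightarrow> 'r set \<Rightarrow> 'c set \<Rightarrow> ('r \<Rightarrow> 'c \<Rightarrow> int) \<Rightarrow> ('r \<Rightarrow> int) \<Rightarrow>
    ('b, 'd) monoid_scheme \<Rightarrow> 'b \<Rightarrow> ('c \<Rightarrow> 'b) \<Rightarrow> bool" where
  "linear_solution d R C A b G J e \<longleftrightarrow>
    J \<in> carrier G \<and> J [^]\<^bsub>G\<^esub> d = \<one>\<^bsub>G\<^esub> \<and>
    (\<forall>c\<in>C. e c \<in> carrier G \<and> e c [^]\<^bsub>G\<^esub> d = \<one>\<^bsub>G\<^esub> \<and> J \<otimes>\<^bsub>G\<^esub> e c = e c \<otimes>\<^bsub>G\<^esub> J) \<and>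
    (\<forall>r\<in>R.
      (\<forall>c\<in>C. \<forall>c'\<in>C. A r c \<noteq> 0 \<longrightarrow> A r c' \<noteq> 0 \<longrightarrow> e c \<otimes>\<^bsub>G\<^esub> e c' = e c' \<otimes>\<^bsub>G\<^esub> e c) \<and>
      (\<forall>cs. distinct cs \<longrightarrow> set cs = {c \<in> C. A r c \<noteq> 0} \<longrightarrow>
        foldr (\<lambda>c g. (e c [^]\<^bsub>G\<^esub> A r c) \<otimes>\<^bsub>G\<^esub> g) cs \<one>\<^bsub>G\<^esub> = J [^]\<^bsub>G\<^esub> b r))"

lemma pi1_solutionD:
  assumes "pi1_solution d Y G e"
  shows "y \<in> simplices Y 1 \<Longrightarrow> e y \<in> carrier G"
    "y \<in> simplices Y 1 \<Longrightarrow> e y [^]\<^bsub>G\<^esub> d = \<one>\<^bsub>G\<^esub>"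
    "\<sigma> \<in> simplices Y 2 \<Longrightarrow> i \<le> 2 \<Longrightarrow> j \<le> 2 \<Longrightarrow> e (face Y 2 i \<sigma>) \<otimes>\<^bsub>G\<^esub> e (face Y 2 j \<sigma>) =
      e (face Y 2 j \<sigma>) \<otimes>\<^bsub>G\<^esub> e (face Y 2 i \<sigma>)"
    "\<sigma> \<in> simplices Y 2 \<Longrightarrow> e (face Y 2 2 \<sigma>) \<otimes>\<^bsub>G\<^esub> e (face Y 2 0 \<sigma>) = e (face Y 2 1 \<sigma>)"
  using assms unfolding pi1_solution_def by blast+

text \<open>
  The equivalence serves twice: read from left to right for the canonical projection it shows that the
  generators satisfy the relations, from right to left it feeds the universal property.
\<close>

lemma pi1_relators_killed_iff:
  assumes "group_hom (free_group (simplices Y 1)) G F"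
    and face: "\<And>i \<sigma>. \<sigma> \<in> simplices Y 2 \<Longrightarrow> i \<le> 2 \<Longrightarrow> face Y 2 i \<sigma> \<in> simplices Y 1"
  shows "F ` pi1_relators d Y \<subseteq> {\<one>\<^bsub>G\<^esub>} \<longleftrightarrow>
    pi1_solution d Y G (\<lambda>y. F (free_gen (simplices Y 1) y))"
proof -
  let ?W = "free_group (simplices Y 1)" and ?e = "free_gen (simplices Y 1)"
  interpret group_hom ?W G F by fact
  have e: "?e y \<in> carrier ?W" if "y \<in> simplices Y 1" for y using that by (rule free_gen_closed)
  have "F ` pi1_relators d Y \<subseteq> {\<one>\<^bsub>G\<^esub>} \<longleftrightarrow>
    (\<forall>y\<in>simplices Y 1. F (?e y [^]\<^bsub>?W\<^esub> d) = \<one>\<^bsub>G\<^esub>) \<and>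
    (\<forall>\<sigma>\<in>simplices Y 2. \<forall>i\<le>2. \<forall>j\<le>2.
      F (commutator ?W (?e (face Y 2 i \<sigma>)) (?e (face Y 2 j \<sigma>))) = \<one>\<^bsub>G\<^esub>) \<and>
    (\<forall>\<sigma>\<in>simplices Y 2. F (?e (face Y 2 2 \<sigma>) \<otimes>\<^bsub>?W\<^esub> ?e (face Y 2 0 \<sigma>) \<otimes>\<^bsub>?W\<^esub>
      inv\<^bsub>?W\<^esub> ?e (face Y 2 1 \<sigma>)) = \<one>\<^bsub>G\<^esub>)"
    unfolding pi1_relators_def Let_def image_subset_iff ball_Un singleton_iff conj_assoc
    by (intro arg_cong2[where f = "(\<and>)"]; blast)
  also have "\<dots> \<longleftrightarrow> pi1_solution d Y G (\<lambda>y. F (?e y))"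
    unfolding pi1_solution_def using e face
    by (auto simp: hom_nat_pow hom_commutator hom_inv H.commutator_eq_one_iff H.mult_inv_eq_one_iff)
  finally show ?thesis .
qed

lemma solution_relators_killed_iff:
  fixes C :: "'c set"
  assumes "group_hom (free_group (solution_syms C)) G F"
  defines "e \<equiv> free_gen (solution_syms C)"
  shows "F ` solution_relators d R C A b \<subseteq> {\<one>\<^bsub>G\<^esub>} \<longleftrightarrow>
    linear_solution d R C A b G (F (e SymJ)) (\<lambda>c. F (e (SymE c)))"
proof -
  let ?W = "free_group (solution_syms C)"
  interpret group_hom ?W G F by fact
  have e: "e (SymE c) \<in> carrier ?W" if "c \<in> C" for c
    using that by (auto simp: e_def solution_syms_def intro: free_gen_closed)
  have J: "e SymJ \<in> carrier ?W"
    by (auto simp: e_def solution_syms_def intro: free_gen_closed)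
  let ?p = "\<lambda>r cs. foldr (\<lambda>c g. (e (SymE c) [^]\<^bsub>?W\<^esub> A r c) \<otimes>\<^bsub>?W\<^esub> g) cs \<one>\<^bsub>?W\<^esub>"
  have p: "?p r cs \<in> carrier ?W" if "set cs \<subseteq> C" for r cs
    using that e by (induction cs) auto
  have Fp: "F (?p r cs \<otimes>\<^bsub>?W\<^esub> inv\<^bsub>?W\<^esub> (e SymJ [^]\<^bsub>?W\<^esub> b r)) = \<one>\<^bsub>G\<^esub> \<longleftrightarrow>
    foldr (\<lambda>c g. (F (e (SymE c)) [^]\<^bsub>G\<^esub> A r c) \<otimes>\<^bsub>G\<^esub> g) cs \<one>\<^bsub>G\<^esub> = F (e SymJ) [^]\<^bsub>G\<^esub> b r"
    if "set cs = {c \<in> C. A r c \<noteq> 0}" for r cs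
  proof -
    have cs: "e (SymE c) \<in> carrier ?W" if "c \<in> set cs" for c
      using that \<open>set cs = _\<close> e by auto
    have pc: "?p r cs \<in> carrier ?W" using that by (intro p) auto
    have "foldr (\<lambda>c g. (F (e (SymE c)) [^]\<^bsub>G\<^esub> A r c) \<otimes>\<^bsub>G\<^esub> g) cs \<one>\<^bsub>G\<^esub> \<in> carrier G"
      using hom_closed[OF pc] by (simp only: hom_foldr_int_pow[OF cs])
    then show ?thesis
      using J pc by (simp add: hom_foldr_int_pow[OF cs] hom_inv hom_int_pow H.mult_inv_eq_one_iff)
  qed
  have "F ` solution_relators d R C A b \<subseteq> {\<one>\<^bsub>G\<^esub>} \<longleftrightarrow>
    F (e SymJ [^]\<^bsub>?W\<^esub> d) = \<one>\<^bsub>G\<^esub> \<and>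
    (\<forall>c\<in>C. F (e (SymE c) [^]\<^bsub>?W\<^esub> d) = \<one>\<^bsub>G\<^esub>) \<and>
    (\<forall>c\<in>C. F (commutator ?W (e SymJ) (e (SymE c))) = \<one>\<^bsub>G\<^esub>) \<and>
    (\<forall>r\<in>R. \<forall>c\<in>C. \<forall>c'\<in>C. A r c \<noteq> 0 \<longrightarrow> A r c' \<noteq> 0 \<longrightarrow>
      F (commutator ?W (e (SymE c)) (e (SymE c'))) = \<one>\<^bsub>G\<^esub>) \<and>
    (\<forall>r\<in>R. \<forall>cs. distinct cs \<longrightarrow> set cs = {c \<in> C. A r c \<noteq> 0} \<longrightarrow>
      F (?p r cs \<otimes>\<^bsub>?W\<^esub> inv\<^bsub>?W\<^esub> (e SymJ [^]\<^bsub>?W\<^esub> b r)) = \<one>\<^bsub>G\<^esub>)"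
    unfolding solution_relators_def Let_def e_def image_subset_iff ball_Un singleton_iff conj_assoc
    by (intro arg_cong2[where f = "(\<and>)"]; blast)
  also have "\<dots> \<longleftrightarrow> linear_solution d R C A b G (F (e SymJ)) (\<lambda>c. F (e (SymE c)))"
    unfolding linear_solution_def using e J
    by (simp add: hom_nat_pow hom_commutator H.commutator_eq_one_iff Fp cong: conj_cong) blast
  finally show ?thesis .
qed

lemma pi1_relators_closed:
  assumes face: "\<And>i \<sigma>. \<sigma> \<in> simplices Y 2 \<Longrightarrow> i \<le> 2 \<Longrightarrow> face Y 2 i \<sigma> \<in> simplices Y 1"
  shows "pi1_relators d Y \<subseteq> carrier (free_group (simplices Y 1))"
proof -
  interpret group "free_group (simplices Y 1)" by (rule group_free_group)
  show ?thesis
    using face by (auto simp: pi1_relators_def Let_def commutator_def free_gen_closed)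
qed

lemma solution_relators_closed:
  "solution_relators d R C A b \<subseteq> carrier (free_group (solution_syms C))"
proof -
  let ?W = "free_group (solution_syms C)" and ?e = "free_gen (solution_syms C)"
  interpret group ?W by (rule group_free_group)
  have e: "?e (SymE c) \<in> carrier ?W" if "c \<in> C" for c
    using that by (auto simp: solution_syms_def intro: free_gen_closed)
  have J: "?e SymJ \<in> carrier ?W"
    by (auto simp: solution_syms_def intro: free_gen_closed)
  have "foldr (\<lambda>c g. (?e (SymE c) [^]\<^bsub>?W\<^esub> A r c) \<otimes>\<^bsub>?W\<^esub> g) cs \<one>\<^bsub>?W\<^esub> \<in> carrier ?W"
    if "set cs \<subseteq> C" for r cs
    using that e by (induction cs) auto
  then show ?thesis
    using e J by (auto simp: solution_relators_def Let_def commutator_def)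
qed

lemma group_pi1:
  assumes "\<And>i \<sigma>. \<sigma> \<in> simplices Y 2 \<Longrightarrow> i \<le> 2 \<Longrightarrow> face Y 2 i \<sigma> \<in> simplices Y 1"
  shows "group (pi1 d Y)"
  unfolding pi1_def by (intro group_presented_group pi1_relators_closed assms)

lemma group_solution_group: "group (solution_group d R C A b)"
  unfolding solution_group_def by (intro group_presented_group solution_relators_closed)

lemma pi1_solution_pi1_gen:
  assumes face: "\<And>i \<sigma>. \<sigma> \<in> simplices Y 2 \<Longrightarrow> i \<le> 2 \<Longrightarrow> face Y 2 i \<sigma> \<in> simplices Y 1"
  shows "pi1_solution d Y (pi1 d Y) (pi1_gen d Y)"
proof -
  note closed = pi1_relators_closed[OF face, of d]
  have "group_hom (free_group (simplices Y 1)) (pi1 d Y)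
      (presented_proj (simplices Y 1) (pi1_relators d Y))"
    unfolding pi1_def
    by (intro group_hom.intro group_hom_axioms.intro group_free_group
        group_presented_group presented_proj_hom closed)
  from pi1_relators_killed_iff[OF this face, of d] show ?thesis
    using presented_proj_relators[OF closed]
    by (simp add: pi1_def pi1_gen_def presented_proj_gen[OF closed])
qed

lemma linear_solution_solution_gen:
  "linear_solution d R C A b (solution_group d R C A b)
    (solution_gen d R C A b SymJ) (\<lambda>c. solution_gen d R C A b (SymE c))"
proof -
  note closed = solution_relators_closed[of d R C A b]
  have "group_hom (free_group (solution_syms C)) (solution_group d R C A b)
      (presented_proj (solution_syms C) (solution_relators d R C A b))"
    unfolding solution_group_def
    by (intro group_hom.intro group_hom_axioms.intro group_free_group
        group_presented_group presented_proj_hom closed)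
  from solution_relators_killed_iff[OF this, of d R A b] show ?thesis
    using presented_proj_relators[OF closed]
    by (simp add: solution_group_def solution_gen_def presented_proj_gen[OF closed])
qed

lemma pi1_universal:
  assumes face: "\<And>i \<sigma>. \<sigma> \<in> simplices Y 2 \<Longrightarrow> i \<le> 2 \<Longrightarrow> face Y 2 i \<sigma> \<in> simplices Y 1"
    and G: "group G" and e: "pi1_solution d Y G e"
  obtains h where "h \<in> hom (pi1 d Y) G" "\<And>y. y \<in> simplices Y 1 \<Longrightarrow> h (pi1_gen d Y y) = e y"
proof -
  have kill: "F ` pi1_relators d Y \<subseteq> {\<one>\<^bsub>G\<^esub>}"
    if F: "F \<in> hom (free_group (simplices Y 1)) G"
      "\<And>s. s \<in> simplices Y 1 \<Longrightarrow> F (free_gen (simplices Y 1) s) = e s" for F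
  proof -
    have "group_hom (free_group (simplices Y 1)) G F"
      using F G by (intro group_hom.intro group_hom_axioms.intro group_free_group)
    moreover have "pi1_solution d Y G (\<lambda>y. F (free_gen (simplices Y 1) y)) \<longleftrightarrow> pi1_solution d Y G e"
      unfolding pi1_solution_def using face F(2) by simp
    ultimately show ?thesis using pi1_relators_killed_iff face e by blast
  qed
  have "e \<in> simplices Y 1 \<rightarrow> carrier G" using e by (auto simp: pi1_solution_def)
  from presented_group_universal[OF pi1_relators_closed[OF face] G this kill] that
  show thesis unfolding pi1_def pi1_gen_def by blast
qed

lemma solution_group_universal:
  assumes G: "group G" and sol: "linear_solution d R C A b G J e"
  obtains h where "h \<in> hom (solution_group d R C A b) G"
    "h (solution_gen d R C A b SymJ) = J"
    "\<And>c. c \<in> C \<Longrightarrow> h (solution_gen d R C A b (SymE c)) = e c"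
proof -
  define \<phi> where "\<phi> s = (case s of SymJ \<Rightarrow> J | SymE c \<Rightarrow> e c)" for s
  let ?S = "solution_syms C"
  have kill: "F ` solution_relators d R C A b \<subseteq> {\<one>\<^bsub>G\<^esub>}"
    if F: "F \<in> hom (free_group ?S) G" "\<And>s. s \<in> ?S \<Longrightarrow> F (free_gen ?S s) = \<phi> s" for F
  proof -
    have hom: "group_hom (free_group ?S) G F"
      using F G by (intro group_hom.intro group_hom_axioms.intro group_free_group)
    have "F (free_gen ?S SymJ) = J" and FE: "\<And>c. c \<in> C \<Longrightarrow> F (free_gen ?S (SymE c)) = e c"
      using F(2) by (auto simp: solution_syms_def \<phi>_def)
    moreover have "foldr (\<lambda>c g. (F (free_gen ?S (SymE c)) [^]\<^bsub>G\<^esub> A r c) \<otimes>\<^bsub>G\<^esub> g) cs \<one>\<^bsub>G\<^esub> =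
        foldr (\<lambda>c g. (e c [^]\<^bsub>G\<^esub> A r c) \<otimes>\<^bsub>G\<^esub> g) cs \<one>\<^bsub>G\<^esub>" if "set cs = {c \<in> C. A r c \<noteq> 0}" for r cs
      using that FE by (intro foldr_cong) auto
    ultimately have "linear_solution d R C A b G (F (free_gen ?S SymJ))
        (\<lambda>c. F (free_gen ?S (SymE c)))"
      using sol by (simp add: linear_solution_def)
    then show ?thesis using solution_relators_killed_iff[OF hom] by blast
  qed
  have "\<phi> \<in> ?S \<rightarrow> carrier G"
    using sol by (auto simp: \<phi>_def solution_syms_def linear_solution_def)
  from presented_group_universal[OF solution_relators_closed G this kill]
  obtain h where h: "h \<in> hom (solution_group d R C A b) G"
      "\<And>s. s \<in> ?S \<Longrightarrow> h (solution_gen d R C A b s) = \<phi> s"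
    unfolding solution_group_def solution_gen_def by blast
  show thesis
    by (rule that[OF h(1)]) (use h(2) in \<open>auto simp: solution_syms_def \<phi>_def\<close>)
qed


section \<open>The linear system of a simplicial set\<close>

context group
begin

lemma power_product_closed:
  fixes k :: "'c \<Rightarrow> int"
  assumes "\<And>c. c \<in> set cs \<Longrightarrow> e c \<in> carrier G"
  shows "foldr (\<lambda>c g. e c [^] k c \<otimes> g) cs \<one> \<in> carrier G"
  using assms by (induction cs) auto

lemma power_product_commute:
  fixes k :: "'c \<Rightarrow> int"
  assumes "x \<in> carrier G" "\<And>c. c \<in> set cs \<Longrightarrow> e c \<in> carrier G \<and> x \<otimes> e c = e c \<otimes> x"
  shows "x \<otimes> foldr (\<lambda>c g. e c [^] k c \<otimes> g) cs \<one> = foldr (\<lambda>c g. e c [^] k c \<otimes> g) cs \<one> \<otimes> x"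
  using assms(2)
proof (induction cs)
  case Nil
  then show ?case using assms(1) by simp
next
  case (Cons c cs)
  interpret Z: subgroup "{h \<in> carrier G. x \<otimes> h = h \<otimes> x}" G
    by (rule centralizer_subgroup[OF assms(1)])
  have "e c [^] k c \<in> {h \<in> carrier G. x \<otimes> h = h \<otimes> x}"
    using commute_int_pow[OF assms(1), of "e c" "k c"] Cons.prems[of c]
    by (simp only: mem_Collect_eq list.set_intros simp_thms int_pow_closed)
  moreover have "foldr (\<lambda>c g. e c [^] k c \<otimes> g) cs \<one> \<in> {h \<in> carrier G. x \<otimes> h = h \<otimes> x}"
    using Cons.IH Cons.prems power_product_closed[of cs e k]
    by (simp only: mem_Collect_eq list.set_intros simp_thms)
  ultimately show ?case
    using Z.m_closed by (simp only: foldr.simps o_apply mem_Collect_eq)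
qed

text \<open>
  For pairwise commuting elements, products of powers are additive in the exponents. This lets the
  matrix row of a triangle be taken apart into the contributions of its three faces, whether or not
  some of these coincide.
\<close>

lemma power_product_add:
  fixes k l :: "'c \<Rightarrow> int"
  assumes "\<And>c. c \<in> set cs \<Longrightarrow> e c \<in> carrier G"
    and "\<And>b c. b \<in> set cs \<Longrightarrow> c \<in> set cs \<Longrightarrow> e b \<otimes> e c = e c \<otimes> e b"
  shows "foldr (\<lambda>c g. e c [^] (k c + l c) \<otimes> g) cs \<one> =
    foldr (\<lambda>c g. e c [^] k c \<otimes> g) cs \<one> \<otimes> foldr (\<lambda>c g. e c [^] l c \<otimes> g) cs \<one>"
  using assms
proof (induction cs)
  case (Cons c cs)
  let ?K = "foldr (\<lambda>c g. e c [^] k c \<otimes> g) cs \<one>" and ?L = "foldr (\<lambda>c g. e c [^] l c \<otimes> g) cs \<one>"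
  have c: "e c \<in> carrier G" using Cons.prems by simp
  have K: "?K \<in> carrier G" and L: "?L \<in> carrier G"
    using Cons.prems by (simp_all add: power_product_closed)
  have "?K \<otimes> e c = e c \<otimes> ?K"
    using Cons.prems by (intro power_product_commute[symmetric]) auto
  then have comm: "?K \<otimes> e c [^] l c = e c [^] l c \<otimes> ?K"
    using c K by (intro commute_int_pow)
  have "e c [^] (k c + l c) \<otimes> (?K \<otimes> ?L) = e c [^] k c \<otimes> (e c [^] l c \<otimes> ?K) \<otimes> ?L"
    using c K L by (simp add: int_pow_mult m_assoc)
  also have "\<dots> = e c [^] k c \<otimes> ?K \<otimes> (e c [^] l c \<otimes> ?L)"
    using c K L by (simp add: comm[symmetric] m_assoc)
  finally show ?case using Cons by simp
qed simp

lemma power_product_zero: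
  fixes k :: "'c \<Rightarrow> int"
  assumes "\<And>c. c \<in> set cs \<Longrightarrow> k c = 0"
  shows "foldr (\<lambda>c g. e c [^] k c \<otimes> g) cs \<one> = \<one>"
  using assms by (induction cs) auto

lemma power_product_single:
  fixes m :: int
  assumes "distinct cs" "y \<in> set cs" "e y \<in> carrier G"
  shows "foldr (\<lambda>c g. e c [^] (if c = y then m else 0) \<otimes> g) cs \<one> = e y [^] m"
  using assms
proof (induction cs)
  case (Cons c cs)
  show ?case
  proof (cases "c = y")
    case True
    then have "foldr (\<lambda>c g. e c [^] (if c = y then m else 0) \<otimes> g) cs \<one> = \<one>"
      using Cons.prems by (intro power_product_zero) auto
    then show ?thesis using True Cons.prems by simp
  next
    case False
    then show ?thesis using Cons by simp
  qed
qed simp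

end

text \<open>
  The row of the matrix at a triangle with faces \<open>x0\<close>, \<open>x1\<close>, \<open>x2\<close>, as a sum of one indicator for each
  face: coinciding faces add up or cancel.
\<close>

definition row_coeff :: "nat \<Rightarrow> 'c \<Rightarrow> 'c \<Rightarrow> 'c \<Rightarrow> 'c \<Rightarrow> int" where
  "row_coeff d x0 x1 x2 c =
    ((if c = x2 then 1 else 0) + (if c = x0 then 1 else 0) + (if c = x1 then -1 else 0)) mod int d"

lemma sset_matrix_eq_row_coeff:
  "sset_matrix d Y \<sigma> x = row_coeff d (face Y 2 0 \<sigma>) (face Y 2 1 \<sigma>) (face Y 2 2 \<sigma>) x"
proof -
  have "(\<Sum>i\<in>{i. i \<le> 2 \<and> face Y 2 i \<sigma> = x}. (-1) ^ i) =
      (\<Sum>i\<le>2. if face Y 2 i \<sigma> = x then (-1) ^ i else (0::int))"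
    by (simp add: sum.inter_filter[symmetric])
  also have "\<dots> = (if x = face Y 2 2 \<sigma> then 1 else 0) + (if x = face Y 2 0 \<sigma> then 1 else 0) +
      (if x = face Y 2 1 \<sigma> then -1 else 0)"
    by (auto simp: numeral_2_eq_2 One_nat_def)
  finally show ?thesis by (simp add: sset_matrix_def row_coeff_def)
qed

text \<open>
  How a face can drop out of the support. If \<open>x0 = x1 \<noteq> x2\<close> or \<open>x1 = x2 \<noteq> x0\<close>, the coefficients \<open>1\<close>
  and \<open>-1\<close> of the double face cancel; if \<open>x0 = x2 \<noteq> x1\<close> and \<open>d = 2\<close>, the coefficient \<open>2\<close> vanishes. In
  each case one single face is left, and its coefficient is \<open>1\<close> modulo \<open>d\<close>.
\<close>

lemma row_coeff_support_cases:
  assumes "d > 1"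
  shows "(\<forall>c\<in>{x0, x1, x2}. row_coeff d x0 x1 x2 c \<noteq> 0) \<or>
    (\<exists>u w. {x0, x1, x2} = {u, w} \<and> row_coeff d x0 x1 x2 u = 1 \<and> row_coeff d x0 x1 x2 w = 0)"
proof -
  have "(-1) mod int d \<noteq> 0" "1 mod int d = 1" using assms by (auto simp: zmod_minus1)
  moreover have "2 mod int d = 0 \<and> (-1) mod int d = 1 \<or> 2 mod int d \<noteq> 0"
    using assms by (cases "d = 2") auto
  ultimately show ?thesis
    by (auto simp: row_coeff_def)
qed

lemma row_coeff_outside: "c \<notin> {x0, x1, x2} \<Longrightarrow> row_coeff d x0 x1 x2 c = 0"
  by (simp add: row_coeff_def)

text \<open>
  The enumeration \<open>cs\<close> of the support is completed to one of all faces, at the cost of factors with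
  exponent zero; then the three indicator parts of the exponents contribute one factor each.
\<close>

lemma (in group) row_product:
  assumes e: "\<And>c. c \<in> {x0, x1, x2} \<Longrightarrow> e c \<in> carrier G \<and> e c [^] (d::nat) = \<one>"
    and comm: "\<And>b c. b \<in> {x0, x1, x2} \<Longrightarrow> c \<in> {x0, x1, x2} \<Longrightarrow> e b \<otimes> e c = e c \<otimes> e b"
    and cs: "distinct cs" "set cs = {c \<in> C. row_coeff d x0 x1 x2 c \<noteq> 0}" "{x0, x1, x2} \<subseteq> C"
  shows "foldr (\<lambda>c g. e c [^] row_coeff d x0 x1 x2 c \<otimes> g) cs \<one> = e x2 \<otimes> e x0 \<otimes> inv (e x1)"
proof -
  let ?T = "{x0, x1, x2}" and ?A = "row_coeff d x0 x1 x2"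
  let ?d = "\<lambda>y m c. if c = y then m else (0::int)"
  obtain ts where ts: "set ts = ?T - set cs" "distinct ts"
    using finite_distinct_list[of "?T - set cs"] by auto
  have csT: "set cs \<subseteq> ?T" using cs(2) row_coeff_outside[of _ x0 x1 x2 d] by auto
  have set: "set (cs @ ts) = ?T" and dist: "distinct (cs @ ts)" using csT ts cs(1) by auto
  have "foldr (\<lambda>c g. e c [^] ?A c \<otimes> g) ts \<one> = \<one>"
    using ts(1) cs(2,3) by (intro power_product_zero) auto
  then have "foldr (\<lambda>c g. e c [^] ?A c \<otimes> g) cs \<one> = foldr (\<lambda>c g. e c [^] ?A c \<otimes> g) (cs @ ts) \<one>"
    by simp
  also have "\<dots> = foldr (\<lambda>c g. e c [^] ((?d x2 1 c + ?d x0 1 c) + ?d x1 (-1) c) \<otimes> g) (cs @ ts) \<one>"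
  proof (rule foldr_cong)
    fix g c assume "c \<in> set (cs @ ts)"
    then have "e c \<in> carrier G" "e c [^] d = \<one>" using e unfolding set by auto
    then show "e c [^] ?A c \<otimes> g = e c [^] ((?d x2 1 c + ?d x0 1 c) + ?d x1 (-1) c) \<otimes> g"
      by (simp only: row_coeff_def int_pow_mod)
  qed simp_all
  also have "\<dots> = foldr (\<lambda>c g. e c [^] (?d x2 1 c + ?d x0 1 c) \<otimes> g) (cs @ ts) \<one> \<otimes>
      foldr (\<lambda>c g. e c [^] ?d x1 (-1) c \<otimes> g) (cs @ ts) \<one>"
    using e comm unfolding set[symmetric] by (intro power_product_add) blast+
  also have "foldr (\<lambda>c g. e c [^] (?d x2 1 c + ?d x0 1 c) \<otimes> g) (cs @ ts) \<one> =
      foldr (\<lambda>c g. e c [^] ?d x2 1 c \<otimes> g) (cs @ ts) \<one> \<otimes>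
      foldr (\<lambda>c g. e c [^] ?d x0 1 c \<otimes> g) (cs @ ts) \<one>"
    using e comm unfolding set[symmetric] by (intro power_product_add) blast+
  also have "foldr (\<lambda>c g. e c [^] ?d x2 1 c \<otimes> g) (cs @ ts) \<one> = e x2 [^] (1::int)"
    using dist set e by (intro power_product_single) auto
  also have "foldr (\<lambda>c g. e c [^] ?d x0 1 c \<otimes> g) (cs @ ts) \<one> = e x0 [^] (1::int)"
    using dist set e by (intro power_product_single) auto
  also have "foldr (\<lambda>c g. e c [^] ?d x1 (-1) c \<otimes> g) (cs @ ts) \<one> = e x1 [^] (-1::int)"
    using dist set e by (intro power_product_single) auto
  finally show ?thesis using e by (simp add: int_pow_neg)
qed

text \<open>
  The relations of \<open>\<Gamma>(A\<^sub>Y, b\<^sub>\<gamma>)\<close> without reference to the support of a row: all faces of a triangle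
  commute and \<open>J\<^bsup>\<gamma>(\<sigma>)\<^esup> e\<^bsub>d\<^sub>2\<sigma>\<^esub> e\<^bsub>d\<^sub>0\<sigma>\<^esub> = e\<^bsub>d\<^sub>1\<sigma>\<^esub>\<close>. It is the relation of \<open>\<pi>\<^sub>1(\<int>\<^sub>d, Y)\<close> up to a central factor.
\<close>

definition twisted_solution ::
  "nat \<Rightarrow> 'a sset \<Rightarrow> ('a \<Rightarrow> int) \<Rightarrow> ('b, 'c) monoid_scheme \<Rightarrow> 'b \<Rightarrow> ('a \<Rightarrow> 'b) \<Rightarrow> bool" where
  "twisted_solution d Y \<gamma> G J e \<longleftrightarrow>
    J \<in> carrier G \<and> J [^]\<^bsub>G\<^esub> d = \<one>\<^bsub>G\<^esub> \<and>
    (\<forall>x\<in>simplices Y 1. e x \<in> carrier G \<and> e x [^]\<^bsub>G\<^esub> d = \<one>\<^bsub>G\<^esub> \<and> J \<otimes>\<^bsub>G\<^esub> e x = e x \<otimes>\<^bsub>G\<^esub> J) \<and>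
    (\<forall>\<sigma>\<in>simplices Y 2.
      (\<forall>i\<le>2. \<forall>j\<le>2. e (face Y 2 i \<sigma>) \<otimes>\<^bsub>G\<^esub> e (face Y 2 j \<sigma>) =
        e (face Y 2 j \<sigma>) \<otimes>\<^bsub>G\<^esub> e (face Y 2 i \<sigma>)) \<and>
      J [^]\<^bsub>G\<^esub> \<gamma> \<sigma> \<otimes>\<^bsub>G\<^esub> (e (face Y 2 2 \<sigma>) \<otimes>\<^bsub>G\<^esub> e (face Y 2 0 \<sigma>)) = e (face Y 2 1 \<sigma>))"

lemma twisted_solutionD:
  assumes "twisted_solution d Y \<gamma> G J e"
  shows "J \<in> carrier G" "J [^]\<^bsub>G\<^esub> d = \<one>\<^bsub>G\<^esub>"
    "x \<in> simplices Y 1 \<Longrightarrow> e x \<in> carrier G"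
    "x \<in> simplices Y 1 \<Longrightarrow> e x [^]\<^bsub>G\<^esub> d = \<one>\<^bsub>G\<^esub>"
    "x \<in> simplices Y 1 \<Longrightarrow> J \<otimes>\<^bsub>G\<^esub> e x = e x \<otimes>\<^bsub>G\<^esub> J"
    "\<sigma> \<in> simplices Y 2 \<Longrightarrow> i \<le> 2 \<Longrightarrow> j \<le> 2 \<Longrightarrow> e (face Y 2 i \<sigma>) \<otimes>\<^bsub>G\<^esub> e (face Y 2 j \<sigma>) =
      e (face Y 2 j \<sigma>) \<otimes>\<^bsub>G\<^esub> e (face Y 2 i \<sigma>)"
    "\<sigma> \<in> simplices Y 2 \<Longrightarrow>
      J [^]\<^bsub>G\<^esub> \<gamma> \<sigma> \<otimes>\<^bsub>G\<^esub> (e (face Y 2 2 \<sigma>) \<otimes>\<^bsub>G\<^esub> e (face Y 2 0 \<sigma>)) = e (face Y 2 1 \<sigma>)"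
  using assms unfolding twisted_solution_def by blast+

lemma le_2_iff: "(\<forall>i\<le>2. P i) \<longleftrightarrow> P 0 \<and> P 1 \<and> P (2::nat)"
  by (auto simp: numeral_2_eq_2 le_Suc_eq One_nat_def)

lemma all_faces_iff:
  "(\<forall>i\<le>2. \<forall>j\<le>2. Q (f i) (f j)) \<longleftrightarrow>
    (\<forall>b\<in>{f 0, f 1, f 2}. \<forall>c\<in>{f 0, f 1, f (2::nat)}. Q b c)"
  by (simp add: le_2_iff)

text \<open>
  The solution group demands commutation only for faces in the support of the row. A face outside it
  commutes all the same: then the support is a single face \<open>u\<close> with coefficient \<open>1\<close>, so the product
  relation makes \<open>e u\<close> a power of the central \<open>J\<close>.
\<close>

lemma (in group) row_relations_iff:
  assumes d: "d > 1" and T: "{x0, x1, x2} \<subseteq> C"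
    and J: "J \<in> carrier G" "J [^] d = \<one>"
    and e: "\<And>c. c \<in> C \<Longrightarrow> e c \<in> carrier G \<and> e c [^] d = \<one> \<and> J \<otimes> e c = e c \<otimes> J"
  defines "A \<equiv> row_coeff d x0 x1 x2"
  shows "(\<forall>c\<in>C. \<forall>c'\<in>C. A c \<noteq> 0 \<longrightarrow> A c' \<noteq> 0 \<longrightarrow> e c \<otimes> e c' = e c' \<otimes> e c) \<and>
      (\<forall>cs. distinct cs \<longrightarrow> set cs = {c \<in> C. A c \<noteq> 0} \<longrightarrow>
        foldr (\<lambda>c g. e c [^] A c \<otimes> g) cs \<one> = J [^] (- z mod int d)) \<longleftrightarrow>
    (\<forall>b\<in>{x0, x1, x2}. \<forall>c\<in>{x0, x1, x2}. e b \<otimes> e c = e c \<otimes> e b) \<and>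
    J [^] z \<otimes> (e x2 \<otimes> e x0) = e x1"
    (is "?comm_supp \<and> ?prod \<longleftrightarrow> ?comm \<and> ?eq")
proof -
  have outside: "A c = 0" if "c \<notin> {x0, x1, x2}" for c
    using row_coeff_outside[OF that] by (simp add: A_def)
  obtain us where us: "distinct us" "set us = {c \<in> C. A c \<noteq> 0}"
    using finite_distinct_list[of "{c \<in> C. A c \<noteq> 0}"] finite_subset[of _ "{x0, x1, x2}"] outside
    by (metis (mono_tags, lifting) finite.emptyI finite.insertI mem_Collect_eq subsetI)
  have prod: "?prod \<longleftrightarrow> ?eq" if comm: ?comm
  proof -
    have row: "foldr (\<lambda>c g. e c [^] A c \<otimes> g) cs \<one> = e x2 \<otimes> e x0 \<otimes> inv (e x1)"
      if "distinct cs" "set cs = {c \<in> C. A c \<noteq> 0}" for cs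
      unfolding A_def using e T comm that by (intro row_product[where C = C]) (auto simp: A_def)
    have "?prod \<longleftrightarrow> e x2 \<otimes> e x0 \<otimes> inv (e x1) = J [^] (- z mod int d)"
      using row us by auto
    also have "\<dots> \<longleftrightarrow> e x2 \<otimes> e x0 \<otimes> inv (e x1) = inv (J [^] z)"
      using J by (simp add: int_pow_mod int_pow_neg)
    also have "\<dots> \<longleftrightarrow> J [^] z \<otimes> (e x2 \<otimes> e x0 \<otimes> inv (e x1)) = \<one>"
      using J(1) e T inv_equality inv_solve_left'
      by (metis insert_subset int_pow_closed inv_closed l_inv m_closed r_inv inv_unique')
    also have "J [^] z \<otimes> (e x2 \<otimes> e x0 \<otimes> inv (e x1)) = J [^] z \<otimes> (e x2 \<otimes> e x0) \<otimes> inv (e x1)"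
      using J(1) e T by (simp add: m_assoc)
    also have "\<dots> = \<one> \<longleftrightarrow> ?eq"
      using J(1) e T by (intro mult_inv_eq_one_iff) auto
    finally show ?thesis .
  qed
  have comm: ?comm if supp: ?comm_supp and prod: ?prod
    using row_coeff_support_cases[OF d, of x0 x1 x2]
  proof
    assume "\<forall>c\<in>{x0, x1, x2}. row_coeff d x0 x1 x2 c \<noteq> 0"
    then show ?comm using supp T unfolding A_def[symmetric] by blast
  next
    assume "\<exists>u w. {x0, x1, x2} = {u, w} \<and> row_coeff d x0 x1 x2 u = 1 \<and> row_coeff d x0 x1 x2 w = 0"
    then obtain u w where uw: "{x0, x1, x2} = {u, w}" "A u = 1" "A w = 0"
      unfolding A_def by blast
    have uC: "u \<in> C" "w \<in> C" using T unfolding uw(1) by auto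
    have "{c \<in> C. A c \<noteq> 0} = {u}" using uw uC outside unfolding uw(1) by auto
    then have "foldr (\<lambda>c g. e c [^] A c \<otimes> g) [u] \<one> = J [^] (- z mod int d)"
      using prod[rule_format, of "[u]"] by simp
    then have eu: "e u = J [^] (- z mod int d)" using uw(2) e[OF uC(1)] by simp
    have "e w \<otimes> e u = e u \<otimes> e w"
      unfolding eu using e[OF uC(2)] J by (intro commute_int_pow) auto
    then show ?comm unfolding uw(1) by auto
  qed
  have supp: ?comm_supp if ?comm using that outside by blast
  show ?thesis using prod comm supp by blast
qed

lemma linear_solution_iff_twisted_solution:
  assumes "group G" "d > 1"
    and face: "\<And>i \<sigma>. \<sigma> \<in> simplices X 2 \<Longrightarrow> i \<le> 2 \<Longrightarrow> face X 2 i \<sigma> \<in> simplices X 1"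
  shows "linear_solution d (simplices X 2) (simplices X 1) (sset_matrix d X) (sset_vector d \<gamma>) G J e
    \<longleftrightarrow> twisted_solution d X \<gamma> G J e"
proof -
  interpret group G by fact
  have row: "(\<forall>c\<in>simplices X 1. \<forall>c'\<in>simplices X 1. sset_matrix d X \<sigma> c \<noteq> 0 \<longrightarrow>
        sset_matrix d X \<sigma> c' \<noteq> 0 \<longrightarrow> e c \<otimes>\<^bsub>G\<^esub> e c' = e c' \<otimes>\<^bsub>G\<^esub> e c) \<and>
      (\<forall>cs. distinct cs \<longrightarrow> set cs = {c \<in> simplices X 1. sset_matrix d X \<sigma> c \<noteq> 0} \<longrightarrow>
        foldr (\<lambda>c g. (e c [^]\<^bsub>G\<^esub> sset_matrix d X \<sigma> c) \<otimes>\<^bsub>G\<^esub> g) cs \<one>\<^bsub>G\<^esub> =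
          J [^]\<^bsub>G\<^esub> sset_vector d \<gamma> \<sigma>) \<longleftrightarrow>
      (\<forall>i\<le>2. \<forall>j\<le>2. e (face X 2 i \<sigma>) \<otimes>\<^bsub>G\<^esub> e (face X 2 j \<sigma>) =
        e (face X 2 j \<sigma>) \<otimes>\<^bsub>G\<^esub> e (face X 2 i \<sigma>)) \<and>
      J [^]\<^bsub>G\<^esub> \<gamma> \<sigma> \<otimes>\<^bsub>G\<^esub> (e (face X 2 2 \<sigma>) \<otimes>\<^bsub>G\<^esub> e (face X 2 0 \<sigma>)) = e (face X 2 1 \<sigma>)"
    if J: "J \<in> carrier G" "J [^]\<^bsub>G\<^esub> d = \<one>\<^bsub>G\<^esub>"
      and e: "\<And>c. c \<in> simplices X 1 \<Longrightarrow>
        e c \<in> carrier G \<and> e c [^]\<^bsub>G\<^esub> d = \<one>\<^bsub>G\<^esub> \<and> J \<otimes>\<^bsub>G\<^esub> e c = e c \<otimes>\<^bsub>G\<^esub> J"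
      and \<sigma>: "\<sigma> \<in> simplices X 2" for \<sigma>
    unfolding sset_vector_def sset_matrix_eq_row_coeff
      all_faces_iff[of "\<lambda>b c. e b \<otimes>\<^bsub>G\<^esub> e c = e c \<otimes>\<^bsub>G\<^esub> e b" "\<lambda>i. face X 2 i \<sigma>"]
    using face[OF \<sigma>] J e by (intro row_relations_iff assms(2)) auto
  show ?thesis
    unfolding linear_solution_def twisted_solution_def
    by (intro conj_cong refl ball_cong row) blast+
qed


section \<open>The twisted product in dimensions one and two\<close>

lemma simplices_twisted_product_1:
  "d > 1 \<Longrightarrow> simplices (twisted_product d X \<gamma>) 1 = {([a], x) | a x. a \<in> {0..<int d} \<and> x \<in> simplices X 1}"
  by (auto simp: twisted_product_def nerve_def carrier_integer_mod_group One_nat_def length_Suc_conv)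

lemma simplices_twisted_product_2:
  "d > 1 \<Longrightarrow> simplices (twisted_product d X \<gamma>) 2 =
    {([a, b], \<sigma>) | a b \<sigma>. a \<in> {0..<int d} \<and> b \<in> {0..<int d} \<and> \<sigma> \<in> simplices X 2}"
  by (auto simp: twisted_product_def nerve_def carrier_integer_mod_group numeral_2_eq_2 length_Suc_conv)

text \<open>
  In dimension two no vertex is deleted, so the twisting function is the cocycle itself.
\<close>

lemma twisting_2: "twisting d X \<gamma> 2 \<sigma> = [\<gamma> \<sigma>]"
proof -
  have "{0..2} - {0, 1, 2} = ({} :: nat set)" by auto
  then have "face_on X 2 {0, 1, 2} \<sigma> = \<sigma>" by (simp only: face_on_def) simp
  moreover have "[1..<2] = [1]" by (simp add: upt_rec)
  ultimately show ?thesis by (simp add: twisting_def)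
qed

lemma face_twisted_product_2:
  "face (twisted_product d X \<gamma>) 2 0 ([a, b], \<sigma>) = ([(\<gamma> \<sigma> + b) mod int d], face X 2 0 \<sigma>)"
  "face (twisted_product d X \<gamma>) 2 1 ([a, b], \<sigma>) = ([(a + b) mod int d], face X 2 1 \<sigma>)"
  "face (twisted_product d X \<gamma>) 2 2 ([a, b], \<sigma>) = ([a], face X 2 2 \<sigma>)"
  by (simp_all add: twisted_product_def nerve_def twisting_2)

lemma simplicial_set_face:
  assumes "simplicial_set X" "\<sigma> \<in> simplices X (Suc n)" "i \<le> Suc n"
  shows "face X (Suc n) i \<sigma> \<in> simplices X n"
  using assms(1)[unfolded simplicial_set_def, THEN conjunct1, rule_format, OF assms(3)] assms(2)
  by (rule funcset_mem)

lemma triangle_face_closed: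
  "simplicial_set X \<Longrightarrow> \<sigma> \<in> simplices X 2 \<Longrightarrow> i \<le> 2 \<Longrightarrow> face X 2 i \<sigma> \<in> simplices X 1"
  using simplicial_set_face[of X \<sigma> 1 i] by (simp add: numeral_2_eq_2 One_nat_def)

lemma simplicial_set_degen:
  assumes "simplicial_set X" "x \<in> simplices X n" "j \<le> n"
  shows "degen X n j x \<in> simplices X (Suc n)"
  using assms(1)[unfolded simplicial_set_def, THEN conjunct2, THEN conjunct1, rule_format, OF assms(3)]
    assms(2)
  by (rule funcset_mem)

lemma twisted_product_face_closed:
  assumes "d > 1" "simplicial_set X"
    and "\<sigma> \<in> simplices (twisted_product d X \<gamma>) 2" "i \<le> 2"
  shows "face (twisted_product d X \<gamma>) 2 i \<sigma> \<in> simplices (twisted_product d X \<gamma>) 1"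
proof -
  have "i \<in> {0, 1, 2}" using assms(4) by auto
  moreover have "face X 2 i \<tau> \<in> simplices X 1" if "\<tau> \<in> simplices X 2" for \<tau>
    by (rule triangle_face_closed[OF assms(2) that assms(4)])
  ultimately show ?thesis
    using assms(1,3)
    by (auto simp: simplices_twisted_product_1 simplices_twisted_product_2 face_twisted_product_2)
qed

lemma degen_edge_faces:
  assumes "simplicial_set X" "x \<in> simplices X 1"
  shows "degen X 1 0 x \<in> simplices X 2" "degen X 1 1 x \<in> simplices X 2"
    "face X 2 0 (degen X 1 0 x) = x" "face X 2 1 (degen X 1 0 x) = x"
    "face X 2 2 (degen X 1 0 x) = degen X 0 0 (face X 1 1 x)"
    "face X 2 0 (degen X 1 1 x) = degen X 0 0 (face X 1 0 x)"
    "face X 2 1 (degen X 1 1 x) = x" "face X 2 2 (degen X 1 1 x) = x"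
proof -
  note ids = assms(1)[unfolded simplicial_set_def, THEN conjunct2, THEN conjunct2, THEN conjunct2]
  have same: "face X (Suc n) j (degen X n j x) = x" "face X (Suc n) (Suc j) (degen X n j x) = x"
    if "x \<in> simplices X n" "j \<le> n" for n j x
    using ids[THEN conjunct2, THEN conjunct1] that by blast+
  have below: "face X (Suc n) i (degen X n j x) = degen X (n - 1) (j - 1) (face X n i x)"
    if "x \<in> simplices X n" "j \<le> n" "i < j" for n i j x
    by (rule ids[THEN conjunct1, rule_format]) (use that in simp_all)
  have above: "face X (Suc n) i (degen X n j x) = degen X (n - 1) j (face X n (i - 1) x)"
    if "x \<in> simplices X n" "j \<le> n" "i \<le> Suc n" "Suc j < i" for n i j x
    by (rule ids[THEN conjunct2, THEN conjunct2, THEN conjunct1, rule_format])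
      (use that in simp_all)
  have two: "Suc 1 = 2" "Suc 0 = 1" by auto
  show "degen X 1 0 x \<in> simplices X 2" "degen X 1 1 x \<in> simplices X 2"
    using simplicial_set_degen[OF assms] by (metis two zero_le le_refl)+
  show "face X 2 0 (degen X 1 0 x) = x" "face X 2 1 (degen X 1 0 x) = x"
    using same[OF assms(2), of 0] by (simp_all add: two)
  show "face X 2 1 (degen X 1 1 x) = x" "face X 2 2 (degen X 1 1 x) = x"
    using same[OF assms(2), of 1] by (simp_all add: two)
  show "face X 2 2 (degen X 1 0 x) = degen X 0 0 (face X 1 1 x)"
    using above[OF assms(2), of 0 2] by (simp add: two)
  show "face X 2 0 (degen X 1 1 x) = degen X 0 0 (face X 1 0 x)"
    using below[OF assms(2), of 1 0] by (simp add: two)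
qed


section \<open>Twisting by powers of a central element\<close>

context group
begin

lemma shift_mult:
  fixes a b :: int
  assumes "J \<in> carrier G" "g \<in> carrier G" "h \<in> carrier G" "J \<otimes> g = g \<otimes> J"
  shows "(J [^] a \<otimes> g) \<otimes> (J [^] b \<otimes> h) = J [^] (a + b) \<otimes> (g \<otimes> h)"
proof -
  have "g \<otimes> J [^] b = J [^] b \<otimes> g" using assms by (intro commute_int_pow) simp_all
  then have "(J [^] a \<otimes> g) \<otimes> (J [^] b \<otimes> h) = J [^] a \<otimes> (J [^] b \<otimes> g) \<otimes> h"
    using assms by (metis m_assoc m_closed int_pow_closed)
  then show ?thesis using assms by (simp add: int_pow_mult m_assoc)
qed

text \<open>
  Central factors cancel from commutation relations. This is why the relations of \<open>\<pi>\<^sub>1(\<int>\<^sub>d, X\<^sub>\<gamma>)\<close> on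
  edges \<open>(a, x)\<close> only depend on the edges \<open>x\<close> of \<open>X\<close>.
\<close>

lemma shift_commute_iff:
  fixes a b :: int
  assumes "J \<in> carrier G" "g \<in> carrier G" "h \<in> carrier G" "J \<otimes> g = g \<otimes> J" "J \<otimes> h = h \<otimes> J"
  shows "(J [^] a \<otimes> g) \<otimes> (J [^] b \<otimes> h) = (J [^] b \<otimes> h) \<otimes> (J [^] a \<otimes> g) \<longleftrightarrow> g \<otimes> h = h \<otimes> g"
  using assms by (simp add: shift_mult add.commute[of b a])

lemma shift_pow:
  fixes a :: int
  assumes "J \<in> carrier G" "g \<in> carrier G" "J \<otimes> g = g \<otimes> J" "J [^] (d::nat) = \<one>" "g [^] d = \<one>"
  shows "(J [^] a \<otimes> g) [^] d = \<one>"
proof -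
  have "g \<otimes> J [^] a = J [^] a \<otimes> g" using assms by (intro commute_int_pow) simp_all
  then have "(J [^] a \<otimes> g) [^] int d = (J [^] a) [^] int d \<otimes> g [^] int d"
    using assms by (intro int_pow_mult_distrib) auto
  also have "(J [^] a) [^] int d = (J [^] int d) [^] a"
    using assms by (simp add: int_pow_pow mult.commute)
  finally show ?thesis using assms by (simp add: int_pow_int)
qed

lemma shift_commute_central:
  fixes a :: int
  assumes "J \<in> carrier G" "g \<in> carrier G" "J \<otimes> g = g \<otimes> J"
  shows "J \<otimes> (J [^] a \<otimes> g) = (J [^] a \<otimes> g) \<otimes> J"
  using shift_mult[of J \<one> g 1 a] shift_mult[of J g \<one> a 1] assms by (simp add: add.commute)

end

text \<open>
  On the triangle \<open>((a, b), \<sigma>)\<close> the edges \<open>d\<^sub>2\<close> and \<open>d\<^sub>0\<close> carry the exponents \<open>a\<close> and \<open>\<gamma>(\<sigma>) + b\<close>, the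
  edge \<open>d\<^sub>1\<close> carries \<open>a + b\<close>. The surplus \<open>\<gamma>(\<sigma>)\<close> is exactly the power of \<open>J\<close> in the relation of the
  solution group.
\<close>

lemma pi1_solution_twisted_product:
  assumes G: "group G" and d: "d > 1" and X: "simplicial_set X"
    and sol: "twisted_solution d X \<gamma> G J e"
  shows "pi1_solution d (twisted_product d X \<gamma>) G (\<lambda>(\<alpha>, x). J [^]\<^bsub>G\<^esub> hd \<alpha> \<otimes>\<^bsub>G\<^esub> e x)"
proof -
  interpret group G by fact
  note J = twisted_solutionD(1,2)[OF sol]
  have e: "e x \<in> carrier G" "e x [^]\<^bsub>G\<^esub> d = \<one>\<^bsub>G\<^esub>" "J \<otimes>\<^bsub>G\<^esub> e x = e x \<otimes>\<^bsub>G\<^esub> J"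
    if "x \<in> simplices X 1" for x
    using twisted_solutionD[OF sol] that by blast+
  have face: "face X 2 i \<sigma> \<in> simplices X 1" if "\<sigma> \<in> simplices X 2" "i \<le> 2" for i \<sigma>
    by (rule triangle_face_closed[OF X that])
  let ?Y = "twisted_product d X \<gamma>" and ?\<epsilon> = "\<lambda>(\<alpha>, x). J [^]\<^bsub>G\<^esub> hd \<alpha> \<otimes>\<^bsub>G\<^esub> e x"
  have edge: "?\<epsilon> y \<in> carrier G \<and> ?\<epsilon> y [^]\<^bsub>G\<^esub> d = \<one>\<^bsub>G\<^esub>" if "y \<in> simplices ?Y 1" for y
  proof -
    obtain a x where y: "y = ([a], x)" "x \<in> simplices X 1"
      using \<open>y \<in> _\<close> by (auto simp: simplices_twisted_product_1[OF d])
    show ?thesis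
      using J e[OF y(2)] shift_pow[OF J(1) e(1)[OF y(2)] e(3)[OF y(2)] J(2) e(2)[OF y(2)], of a]
      by (simp add: y(1))
  qed
  have tri: "(\<forall>i\<le>2. \<forall>j\<le>2. ?\<epsilon> (face ?Y 2 i \<tau>) \<otimes>\<^bsub>G\<^esub> ?\<epsilon> (face ?Y 2 j \<tau>) =
        ?\<epsilon> (face ?Y 2 j \<tau>) \<otimes>\<^bsub>G\<^esub> ?\<epsilon> (face ?Y 2 i \<tau>)) \<and>
      ?\<epsilon> (face ?Y 2 2 \<tau>) \<otimes>\<^bsub>G\<^esub> ?\<epsilon> (face ?Y 2 0 \<tau>) = ?\<epsilon> (face ?Y 2 1 \<tau>)"
    if "\<tau> \<in> simplices ?Y 2" for \<tau>
  proof -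
    obtain a b \<sigma> where \<tau>: "\<tau> = ([a, b], \<sigma>)" and \<sigma>: "\<sigma> \<in> simplices X 2"
      using \<open>\<tau> \<in> _\<close> by (auto simp: simplices_twisted_product_2[OF d])
    define k where "k i = (if i = 0 then \<gamma> \<sigma> + b else if i = 1 then a + b else a)" for i :: nat
    have \<epsilon>: "?\<epsilon> (face ?Y 2 i \<tau>) = J [^]\<^bsub>G\<^esub> k i \<otimes>\<^bsub>G\<^esub> e (face X 2 i \<sigma>)" if "i \<le> 2" for i
    proof -
      have "i \<in> {0, 1, 2}" using that by auto
      then show ?thesis
        using J by (auto simp: \<tau> k_def face_twisted_product_2 int_pow_mod)
    qed
    have comm: "e (face X 2 i \<sigma>) \<otimes>\<^bsub>G\<^esub> e (face X 2 j \<sigma>) = e (face X 2 j \<sigma>) \<otimes>\<^bsub>G\<^esub> e (face X 2 i \<sigma>)"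
      if "i \<le> 2" "j \<le> 2" for i j
      by (rule twisted_solutionD(6)[OF sol \<sigma> that])
    have "?\<epsilon> (face ?Y 2 i \<tau>) \<otimes>\<^bsub>G\<^esub> ?\<epsilon> (face ?Y 2 j \<tau>) =
        ?\<epsilon> (face ?Y 2 j \<tau>) \<otimes>\<^bsub>G\<^esub> ?\<epsilon> (face ?Y 2 i \<tau>)" if "i \<le> 2" "j \<le> 2" for i j
      unfolding \<epsilon>[OF that(1)] \<epsilon>[OF that(2)]
      using face[OF \<sigma> that(1)] face[OF \<sigma> that(2)] comm[OF that]
      by (subst shift_commute_iff) (simp_all add: J e)
    moreover have "?\<epsilon> (face ?Y 2 2 \<tau>) \<otimes>\<^bsub>G\<^esub> ?\<epsilon> (face ?Y 2 0 \<tau>) = ?\<epsilon> (face ?Y 2 1 \<tau>)"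
    proof -
      have f: "face X 2 0 \<sigma> \<in> simplices X 1" "face X 2 1 \<sigma> \<in> simplices X 1"
          "face X 2 2 \<sigma> \<in> simplices X 1"
        using face[OF \<sigma>] by auto
      have "?\<epsilon> (face ?Y 2 2 \<tau>) \<otimes>\<^bsub>G\<^esub> ?\<epsilon> (face ?Y 2 0 \<tau>) =
          J [^]\<^bsub>G\<^esub> (k 2 + k 0) \<otimes>\<^bsub>G\<^esub> (e (face X 2 2 \<sigma>) \<otimes>\<^bsub>G\<^esub> e (face X 2 0 \<sigma>))"
        using \<epsilon>[of 2] \<epsilon>[of 0] shift_mult[OF J(1)] e[OF f(3)] e[OF f(1)] by simp
      also have "k 2 + k 0 = k 1 + \<gamma> \<sigma>" by (simp add: k_def)
      also have "J [^]\<^bsub>G\<^esub> (k 1 + \<gamma> \<sigma>) \<otimes>\<^bsub>G\<^esub> (e (face X 2 2 \<sigma>) \<otimes>\<^bsub>G\<^esub> e (face X 2 0 \<sigma>)) =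
          J [^]\<^bsub>G\<^esub> k 1 \<otimes>\<^bsub>G\<^esub> (J [^]\<^bsub>G\<^esub> \<gamma> \<sigma> \<otimes>\<^bsub>G\<^esub> (e (face X 2 2 \<sigma>) \<otimes>\<^bsub>G\<^esub> e (face X 2 0 \<sigma>)))"
        using J(1) e(1)[OF f(1)] e(1)[OF f(3)] by (simp add: int_pow_mult m_assoc)
      also have "\<dots> = ?\<epsilon> (face ?Y 2 1 \<tau>)"
        unfolding twisted_solutionD(7)[OF sol \<sigma>] using \<epsilon>[of 1] by simp
      finally show ?thesis .
    qed
    ultimately show ?thesis by blast
  qed
  show ?thesis unfolding pi1_solution_def using edge tri by blast
qed

text \<open>
  Multiplying the generators by central powers prescribed by a \<open>1\<close>-cochain \<open>k\<close> subtracts the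
  coboundary of \<open>k\<close> from the cocycle.
\<close>

lemma twisted_solution_shift:
  assumes G: "group G" and X: "simplicial_set X" and sol: "twisted_solution d X \<gamma> G J e"
    and \<gamma>': "\<And>\<sigma>. \<sigma> \<in> simplices X 2 \<Longrightarrow>
      (\<gamma>' \<sigma> + (k (face X 2 0 \<sigma>) - k (face X 2 1 \<sigma>) + k (face X 2 2 \<sigma>))) mod int d = \<gamma> \<sigma> mod int d"
  shows "twisted_solution d X \<gamma>' G J (\<lambda>x. J [^]\<^bsub>G\<^esub> k x \<otimes>\<^bsub>G\<^esub> e x)"
proof -
  interpret group G by fact
  note J = twisted_solutionD(1,2)[OF sol]
  have e: "e x \<in> carrier G" "e x [^]\<^bsub>G\<^esub> d = \<one>\<^bsub>G\<^esub>" "J \<otimes>\<^bsub>G\<^esub> e x = e x \<otimes>\<^bsub>G\<^esub> J"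
    if "x \<in> simplices X 1" for x
    using twisted_solutionD[OF sol] that by blast+
  have face: "face X 2 i \<sigma> \<in> simplices X 1" if "\<sigma> \<in> simplices X 2" "i \<le> 2" for i \<sigma>
    by (rule triangle_face_closed[OF X that])
  let ?e = "\<lambda>x. J [^]\<^bsub>G\<^esub> k x \<otimes>\<^bsub>G\<^esub> e x"
  have edge: "?e x \<in> carrier G \<and> ?e x [^]\<^bsub>G\<^esub> d = \<one>\<^bsub>G\<^esub> \<and> J \<otimes>\<^bsub>G\<^esub> ?e x = ?e x \<otimes>\<^bsub>G\<^esub> J"
    if "x \<in> simplices X 1" for x
    using J e[OF that] by (simp add: shift_pow shift_commute_central)
  have comm: "?e (face X 2 i \<sigma>) \<otimes>\<^bsub>G\<^esub> ?e (face X 2 j \<sigma>) = ?e (face X 2 j \<sigma>) \<otimes>\<^bsub>G\<^esub> ?e (face X 2 i \<sigma>)"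
    if "\<sigma> \<in> simplices X 2" "i \<le> 2" "j \<le> 2" for i j \<sigma>
  proof -
    have "e (face X 2 i \<sigma>) \<otimes>\<^bsub>G\<^esub> e (face X 2 j \<sigma>) = e (face X 2 j \<sigma>) \<otimes>\<^bsub>G\<^esub> e (face X 2 i \<sigma>)"
      using twisted_solutionD[OF sol] that by blast+
    then show ?thesis
      using face[OF that(1,2)] face[OF that(1,3)]
      by (subst shift_commute_iff) (simp_all add: J e)
  qed
  have rel: "J [^]\<^bsub>G\<^esub> \<gamma>' \<sigma> \<otimes>\<^bsub>G\<^esub> (?e (face X 2 2 \<sigma>) \<otimes>\<^bsub>G\<^esub> ?e (face X 2 0 \<sigma>)) = ?e (face X 2 1 \<sigma>)"
    if \<sigma>: "\<sigma> \<in> simplices X 2" for \<sigma>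
  proof -
    let ?x = "\<lambda>i. face X 2 i \<sigma>"
    have f: "?x 0 \<in> simplices X 1" "?x 1 \<in> simplices X 1" "?x 2 \<in> simplices X 1"
      using face[OF \<sigma>] by auto
    have "(\<gamma>' \<sigma> + (k (?x 2) + k (?x 0))) mod int d =
        ((\<gamma>' \<sigma> + (k (?x 0) - k (?x 1) + k (?x 2))) mod int d + k (?x 1)) mod int d"
      by (simp add: mod_simps algebra_simps)
    also have "\<dots> = (k (?x 1) + \<gamma> \<sigma>) mod int d"
      unfolding \<gamma>'[OF \<sigma>] by (simp add: mod_simps add.commute)
    finally have exps: "J [^]\<^bsub>G\<^esub> (\<gamma>' \<sigma> + (k (?x 2) + k (?x 0))) = J [^]\<^bsub>G\<^esub> (k (?x 1) + \<gamma> \<sigma>)"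
      using J int_pow_mod by metis
    have "J [^]\<^bsub>G\<^esub> \<gamma>' \<sigma> \<otimes>\<^bsub>G\<^esub> (?e (?x 2) \<otimes>\<^bsub>G\<^esub> ?e (?x 0)) =
        J [^]\<^bsub>G\<^esub> (\<gamma>' \<sigma> + (k (?x 2) + k (?x 0))) \<otimes>\<^bsub>G\<^esub> (e (?x 2) \<otimes>\<^bsub>G\<^esub> e (?x 0))"
      unfolding shift_mult[OF J(1) e(1)[OF f(3)] e(1)[OF f(1)] e(3)[OF f(3)]]
      using e(1)[OF f(3)] e(1)[OF f(1)] J(1) by (simp add: int_pow_mult m_assoc)
    also have "\<dots> = J [^]\<^bsub>G\<^esub> k (?x 1) \<otimes>\<^bsub>G\<^esub> (J [^]\<^bsub>G\<^esub> \<gamma> \<sigma> \<otimes>\<^bsub>G\<^esub> (e (?x 2) \<otimes>\<^bsub>G\<^esub> e (?x 0)))"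
      unfolding exps using e(1)[OF f(3)] e(1)[OF f(1)] J(1) by (simp add: int_pow_mult m_assoc)
    also have "\<dots> = ?e (?x 1)"
      by (simp only: twisted_solutionD(7)[OF sol \<sigma>])
    finally show ?thesis .
  qed
  show ?thesis unfolding twisted_solution_def using J edge comm rel by blast
qed


section \<open>The central generator of the twisted product\<close>

text \<open>
  Where \<open>J\<close> comes from: the edges over degenerate edges \<open>s\<^sub>0 v\<close>. Since \<open>\<gamma>\<close> is normalized, the triangles
  over \<open>s\<^sub>0 x\<close> and \<open>s\<^sub>1 x\<close> say that \<open>\<epsilon>(a, s\<^sub>0 v)\<close> commutes with \<open>\<epsilon>(b, x)\<close>, and that their product is
  \<open>\<epsilon>(a + b, x)\<close>, when \<open>v\<close> is the source or the target of \<open>x\<close>. With \<open>b = 0\<close> this shows that the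
  elements of source and target agree, so by connectedness \<open>\<epsilon>(a, s\<^sub>0 v)\<close> does not depend on \<open>v\<close> and
  commutes with every \<open>\<epsilon>(b, x)\<close>. Being additive in \<open>a\<close>, it is the \<open>a\<close>-th power of \<open>J = \<epsilon>(1, s\<^sub>0 v)\<close>.
\<close>

lemma twisted_solution_of_pi1_solution:
  assumes G: "group G" and d: "d > 1" and X: "simplicial_set X" "connected_sset X"
    and \<gamma>: "normalized_2cocycle d X \<gamma>"
    and sol: "pi1_solution d (twisted_product d X \<gamma>) G \<epsilon>"
    and v: "v \<in> simplices X 0"
  defines "J \<equiv> \<epsilon> ([1], degen X 0 0 v)" and "e \<equiv> \<lambda>x. \<epsilon> ([0], x)"
  shows "twisted_solution d X \<gamma> G J e"
    and "\<And>a x. a \<in> {0..<int d} \<Longrightarrow> x \<in> simplices X 1 \<Longrightarrow> \<epsilon> ([a], x) = J [^]\<^bsub>G\<^esub> a \<otimes>\<^bsub>G\<^esub> e x"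
proof -
  interpret group G by fact
  let ?Y = "twisted_product d X \<gamma>"
  have \<gamma>0: "\<gamma> (degen X 1 0 x) = 0" "\<gamma> (degen X 1 1 x) = 0" if "x \<in> simplices X 1" for x
    using \<gamma> that by (auto simp: normalized_2cocycle_def)
  have \<gamma>d: "\<gamma> \<sigma> \<in> {0..<int d}" if "\<sigma> \<in> simplices X 2" for \<sigma>
    using \<gamma> that d
    by (auto simp: normalized_2cocycle_def cocycles_def kernel_def cochains_def
        carrier_integer_mod_group PiE_iff)
  have face: "face X 2 i \<sigma> \<in> simplices X 1" if "\<sigma> \<in> simplices X 2" "i \<le> 2" for i \<sigma>
    by (rule triangle_face_closed[OF X(1) that])
  have edge: "([a], x) \<in> simplices ?Y 1" if "a \<in> {0..<int d}" "x \<in> simplices X 1" for a x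
    using that by (simp add: simplices_twisted_product_1[OF d])
  have tri: "([a, b], \<sigma>) \<in> simplices ?Y 2"
    if "a \<in> {0..<int d}" "b \<in> {0..<int d}" "\<sigma> \<in> simplices X 2" for a b \<sigma>
    using that by (simp add: simplices_twisted_product_2[OF d])
  have closed: "\<epsilon> ([a], x) \<in> carrier G" if "a \<in> {0..<int d}" "x \<in> simplices X 1" for a x
    using pi1_solutionD(1)[OF sol edge[OF that]] .
  have zero: "0 \<in> {0..<int d}" and one: "1 \<in> {0..<int d}" using d by auto
  have s0: "degen X 0 0 u \<in> simplices X 1" if "u \<in> simplices X 0" for u
    using simplicial_set_degen[OF X(1) that, of 0] by (simp add: One_nat_def)
  have ends: "face X 1 1 x \<in> simplices X 0" "face X 1 0 x \<in> simplices X 0"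
    if "x \<in> simplices X 1" for x
    using simplicial_set_face[OF X(1), of x 0] that by (simp_all add: One_nat_def)

  \<comment> \<open>the elements over the degenerate edges, which will turn out to be the powers of \<open>J\<close>\<close>
  define z where "z u a = \<epsilon> ([a], degen X 0 0 u)" for u a
  have z_closed: "z u a \<in> carrier G" if "u \<in> simplices X 0" "a \<in> {0..<int d}" for u a
    unfolding z_def using that by (intro closed s0)
  have source: "z (face X 1 1 x) a \<otimes>\<^bsub>G\<^esub> \<epsilon> ([b], x) = \<epsilon> ([(a + b) mod int d], x)"
    "z (face X 1 1 x) a \<otimes>\<^bsub>G\<^esub> \<epsilon> ([b], x) = \<epsilon> ([b], x) \<otimes>\<^bsub>G\<^esub> z (face X 1 1 x) a"
    if x: "x \<in> simplices X 1" and a: "a \<in> {0..<int d}" and b: "b \<in> {0..<int d}" for x a b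
  proof -
    note s = tri[OF a b degen_edge_faces(1)[OF X(1) x]]
    note f = face_twisted_product_2[of d X \<gamma> a b "degen X 1 0 x"]
      degen_edge_faces[OF X(1) x] \<gamma>0[OF x]
    show "z (face X 1 1 x) a \<otimes>\<^bsub>G\<^esub> \<epsilon> ([b], x) = \<epsilon> ([(a + b) mod int d], x)"
      using pi1_solutionD(4)[OF sol s] b by (simp add: f z_def)
    show "z (face X 1 1 x) a \<otimes>\<^bsub>G\<^esub> \<epsilon> ([b], x) = \<epsilon> ([b], x) \<otimes>\<^bsub>G\<^esub> z (face X 1 1 x) a"
      using pi1_solutionD(3)[OF sol s, of 2 0] b by (simp add: f z_def)
  qed
  have target: "\<epsilon> ([a], x) \<otimes>\<^bsub>G\<^esub> z (face X 1 0 x) b = \<epsilon> ([(a + b) mod int d], x)"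
    "\<epsilon> ([a], x) \<otimes>\<^bsub>G\<^esub> z (face X 1 0 x) b = z (face X 1 0 x) b \<otimes>\<^bsub>G\<^esub> \<epsilon> ([a], x)"
    if x: "x \<in> simplices X 1" and a: "a \<in> {0..<int d}" and b: "b \<in> {0..<int d}" for x a b
  proof -
    note s = tri[OF a b degen_edge_faces(2)[OF X(1) x]]
    note f = face_twisted_product_2[of d X \<gamma> a b "degen X 1 1 x"]
      degen_edge_faces[OF X(1) x] \<gamma>0[OF x]
    show "\<epsilon> ([a], x) \<otimes>\<^bsub>G\<^esub> z (face X 1 0 x) b = \<epsilon> ([(a + b) mod int d], x)"
      using pi1_solutionD(4)[OF sol s] b by (simp add: f z_def)
    show "\<epsilon> ([a], x) \<otimes>\<^bsub>G\<^esub> z (face X 1 0 x) b = z (face X 1 0 x) b \<otimes>\<^bsub>G\<^esub> \<epsilon> ([a], x)"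
      using pi1_solutionD(3)[OF sol s, of 2 0] b by (simp add: f z_def)
  qed
  have along: "z (face X 1 1 x) a = z (face X 1 0 x) a"
    if x: "x \<in> simplices X 1" and a: "a \<in> {0..<int d}" for x a
  proof -
    have "z (face X 1 1 x) a \<otimes>\<^bsub>G\<^esub> \<epsilon> ([0], x) = z (face X 1 0 x) a \<otimes>\<^bsub>G\<^esub> \<epsilon> ([0], x)"
      using source(1)[OF x a zero] target[OF x zero a] by simp
    then show ?thesis
      using z_closed[OF ends(1)[OF x] a] z_closed[OF ends(2)[OF x] a] closed[OF zero x]
      by (simp only: right_cancel)
  qed
  have const: "z u a = z v a" if u: "u \<in> simplices X 0" and a: "a \<in> {0..<int d}" for u a
  proof -
    let ?E = "{(face X 1 1 x, face X 1 0 x) | x. x \<in> simplices X 1}"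
    have "(v, u) \<in> (?E \<union> ?E\<inverse>)\<^sup>*" using X(2) u v by (auto simp: connected_sset_def Let_def)
    then show ?thesis
    proof (induction rule: rtrancl_induct)
      case (step y w)
      then have "z y a = z w a" using along[OF _ a] by auto
      then show ?case using step.IH by simp
    qed simp
  qed
  have z_mult: "z v a \<otimes>\<^bsub>G\<^esub> \<epsilon> ([b], x) = \<epsilon> ([(a + b) mod int d], x)"
    and z_comm: "z v a \<otimes>\<^bsub>G\<^esub> \<epsilon> ([b], x) = \<epsilon> ([b], x) \<otimes>\<^bsub>G\<^esub> z v a"
    if "x \<in> simplices X 1" "a \<in> {0..<int d}" "b \<in> {0..<int d}" for x a b
    using source[OF that] unfolding const[OF ends(1)[OF that(1)] that(2)] by auto

  have J: "J = z v 1" by (simp add: J_def z_def)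
  have J_closed: "J \<in> carrier G" unfolding J using v one by (rule z_closed)
  have J_pow: "J [^]\<^bsub>G\<^esub> d = \<one>\<^bsub>G\<^esub>"
    unfolding J_def using pi1_solutionD(2)[OF sol edge[OF one s0[OF v]]] .
  have shift: "J [^]\<^bsub>G\<^esub> n \<otimes>\<^bsub>G\<^esub> e x = \<epsilon> ([int n], x)"
    if x: "x \<in> simplices X 1" and "n < d" for n x
    using that(2)
  proof (induction n)
    case 0
    then show ?case using closed[OF zero x] by (simp add: e_def)
  next
    case (Suc n)
    have "J [^]\<^bsub>G\<^esub> Suc n \<otimes>\<^bsub>G\<^esub> e x = J \<otimes>\<^bsub>G\<^esub> (J [^]\<^bsub>G\<^esub> n \<otimes>\<^bsub>G\<^esub> e x)"
      using J_closed closed[OF zero x] by (simp only: nat_pow_Suc2 m_assoc e_def nat_pow_closed)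
    also have "\<dots> = J \<otimes>\<^bsub>G\<^esub> \<epsilon> ([int n], x)" using Suc by simp
    also have "\<dots> = \<epsilon> ([(1 + int n) mod int d], x)"
      unfolding J using Suc.prems by (intro z_mult x one) auto
    finally show ?case using Suc.prems by simp
  qed
  show shift': "\<epsilon> ([a], x) = J [^]\<^bsub>G\<^esub> a \<otimes>\<^bsub>G\<^esub> e x" if "a \<in> {0..<int d}" "x \<in> simplices X 1" for a x
    using shift[OF that(2), of "nat a"] that(1) by (simp add: nat_less_iff flip: int_pow_int)
  have e_closed: "e x \<in> carrier G" if "x \<in> simplices X 1" for x
    unfolding e_def using closed[OF zero that] .
  have Je: "J \<otimes>\<^bsub>G\<^esub> e x = e x \<otimes>\<^bsub>G\<^esub> J" if "x \<in> simplices X 1" for x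
    unfolding J e_def using z_comm[OF that one zero] .
  have comm: "e (face X 2 i \<sigma>) \<otimes>\<^bsub>G\<^esub> e (face X 2 j \<sigma>) = e (face X 2 j \<sigma>) \<otimes>\<^bsub>G\<^esub> e (face X 2 i \<sigma>)"
    and rel: "J [^]\<^bsub>G\<^esub> \<gamma> \<sigma> \<otimes>\<^bsub>G\<^esub> (e (face X 2 2 \<sigma>) \<otimes>\<^bsub>G\<^esub> e (face X 2 0 \<sigma>)) = e (face X 2 1 \<sigma>)"
    if \<sigma>: "\<sigma> \<in> simplices X 2" and ij: "i \<le> 2" "j \<le> 2" for \<sigma> i j
  proof -
    \<comment> \<open>Over \<open>(0, 0)\<close> the twist shows in \<open>d\<^sub>0\<close> only, which lies over \<open>\<gamma>(\<sigma>)\<close>.\<close>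
    note s = tri[OF zero zero \<sigma>]
    define k where "k i = (if i = 0 then \<gamma> \<sigma> else 0)" for i :: nat
    have \<epsilon>: "\<epsilon> (face ?Y 2 i ([0, 0], \<sigma>)) = J [^]\<^bsub>G\<^esub> k i \<otimes>\<^bsub>G\<^esub> e (face X 2 i \<sigma>)" if "i \<le> 2" for i
    proof -
      have "i \<in> {0, 1, 2}" using that by auto
      then show ?thesis
        using face[OF \<sigma> that] zero \<gamma>d[OF \<sigma>]
        by (auto simp: k_def face_twisted_product_2 shift')
    qed
    show "e (face X 2 i \<sigma>) \<otimes>\<^bsub>G\<^esub> e (face X 2 j \<sigma>) = e (face X 2 j \<sigma>) \<otimes>\<^bsub>G\<^esub> e (face X 2 i \<sigma>)"
      using pi1_solutionD(3)[OF sol s ij] face[OF \<sigma> ij(1)] face[OF \<sigma> ij(2)]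
      unfolding \<epsilon>[OF ij(1)] \<epsilon>[OF ij(2)]
      by (subst (asm) shift_commute_iff) (simp_all add: J_closed e_closed Je)
    have f: "face X 2 0 \<sigma> \<in> simplices X 1" "face X 2 1 \<sigma> \<in> simplices X 1"
        "face X 2 2 \<sigma> \<in> simplices X 1"
      using face[OF \<sigma>] by auto
    have "J [^]\<^bsub>G\<^esub> k 2 \<otimes>\<^bsub>G\<^esub> e (face X 2 2 \<sigma>) \<otimes>\<^bsub>G\<^esub> (J [^]\<^bsub>G\<^esub> k 0 \<otimes>\<^bsub>G\<^esub> e (face X 2 0 \<sigma>)) =
        J [^]\<^bsub>G\<^esub> k 1 \<otimes>\<^bsub>G\<^esub> e (face X 2 1 \<sigma>)"
      using pi1_solutionD(4)[OF sol s] \<epsilon>[of 0] \<epsilon>[of 1] \<epsilon>[of 2] by simp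
    then show "J [^]\<^bsub>G\<^esub> \<gamma> \<sigma> \<otimes>\<^bsub>G\<^esub> (e (face X 2 2 \<sigma>) \<otimes>\<^bsub>G\<^esub> e (face X 2 0 \<sigma>)) = e (face X 2 1 \<sigma>)"
      unfolding shift_mult[OF J_closed e_closed[OF f(3)] e_closed[OF f(1)] Je[OF f(3)]]
      using e_closed[OF f(2)] by (simp add: k_def)
  qed
  have e_pow: "e x [^]\<^bsub>G\<^esub> d = \<one>\<^bsub>G\<^esub>" if "x \<in> simplices X 1" for x
    unfolding e_def using pi1_solutionD(2)[OF sol edge[OF zero that]] .
  show "twisted_solution d X \<gamma> G J e"
    unfolding twisted_solution_def using J_closed J_pow e_closed e_pow Je comm rel by blast
qed


section \<open>The isomorphisms\<close>

lemma twisted_solution_Gamma_gen: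
  assumes "d > 1" "simplicial_set X"
  shows "twisted_solution d X \<gamma> (Gamma d X \<gamma>) (Gamma_gen d X \<gamma> SymJ) (\<lambda>x. Gamma_gen d X \<gamma> (SymE x))"
proof -
  have "face X 2 i \<sigma> \<in> simplices X 1" if "\<sigma> \<in> simplices X 2" "i \<le> 2" for i \<sigma>
    by (rule triangle_face_closed[OF assms(2) that])
  then show ?thesis
    unfolding Gamma_def Gamma_gen_def
    using linear_solution_iff_twisted_solution[OF group_solution_group assms(1)]
      linear_solution_solution_gen by blast
qed

lemma Gamma_universal:
  assumes d: "d > 1" and X: "simplicial_set X" and G: "group G"
    and sol: "twisted_solution d X \<gamma> G J e"
  obtains h where "h \<in> hom (Gamma d X \<gamma>) G" "h (Gamma_gen d X \<gamma> SymJ) = J"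
    "\<And>x. x \<in> simplices X 1 \<Longrightarrow> h (Gamma_gen d X \<gamma> (SymE x)) = e x"
proof -
  have face: "face X 2 i \<sigma> \<in> simplices X 1" if "\<sigma> \<in> simplices X 2" "i \<le> 2" for i \<sigma>
    by (rule triangle_face_closed[OF X that])
  have "linear_solution d (simplices X 2) (simplices X 1) (sset_matrix d X) (sset_vector d \<gamma>) G J e"
    using linear_solution_iff_twisted_solution[OF G d] face sol by blast
  from solution_group_universal[OF G this] that show thesis
    unfolding Gamma_def Gamma_gen_def by blast
qed

lemma group_Gamma: "group (Gamma d X \<gamma>)"
  unfolding Gamma_def by (rule group_solution_group)

lemma solution_syms_cases: "s \<in> solution_syms C \<Longrightarrow> s = SymJ \<or> (\<exists>c\<in>C. s = SymE c)"
  by (auto simp: solution_syms_def)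

lemma Gamma_shift_hom:
  assumes d: "d > 1" and X: "simplicial_set X"
    and \<gamma>': "\<And>\<sigma>. \<sigma> \<in> simplices X 2 \<Longrightarrow>
      (\<gamma> \<sigma> + (k (face X 2 0 \<sigma>) - k (face X 2 1 \<sigma>) + k (face X 2 2 \<sigma>))) mod int d = \<gamma>' \<sigma> mod int d"
  obtains h where "h \<in> hom (Gamma d X \<gamma>) (Gamma d X \<gamma>')"
    "h (Gamma_gen d X \<gamma> SymJ) = Gamma_gen d X \<gamma>' SymJ"
    "\<And>x. x \<in> simplices X 1 \<Longrightarrow> h (Gamma_gen d X \<gamma> (SymE x)) =
      Gamma_gen d X \<gamma>' SymJ [^]\<^bsub>Gamma d X \<gamma>'\<^esub> k x \<otimes>\<^bsub>Gamma d X \<gamma>'\<^esub> Gamma_gen d X \<gamma>' (SymE x)"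
  using Gamma_universal[OF d X group_Gamma twisted_solution_shift[OF group_Gamma X
      twisted_solution_Gamma_gen[OF d X] \<gamma>']] that by blast

text \<open>
  The inverse comes from \<open>- k\<close>, whose coboundary leads back from \<open>\<gamma>'\<close> to \<open>\<gamma>\<close>.
\<close>

lemma Gamma_iso_of_cohomologous:
  assumes d: "d > 1" and X: "simplicial_set X"
    and \<gamma>': "\<And>\<sigma>. \<sigma> \<in> simplices X 2 \<Longrightarrow>
      (\<gamma> \<sigma> + (k (face X 2 0 \<sigma>) - k (face X 2 1 \<sigma>) + k (face X 2 2 \<sigma>))) mod int d = \<gamma>' \<sigma> mod int d"
  shows "Gamma d X \<gamma> \<cong> Gamma d X \<gamma>'"
proof -
  obtain f where f: "f \<in> hom (Gamma d X \<gamma>) (Gamma d X \<gamma>')"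
    "f (Gamma_gen d X \<gamma> SymJ) = Gamma_gen d X \<gamma>' SymJ"
    "\<And>x. x \<in> simplices X 1 \<Longrightarrow> f (Gamma_gen d X \<gamma> (SymE x)) =
      Gamma_gen d X \<gamma>' SymJ [^]\<^bsub>Gamma d X \<gamma>'\<^esub> k x \<otimes>\<^bsub>Gamma d X \<gamma>'\<^esub> Gamma_gen d X \<gamma>' (SymE x)"
    using Gamma_shift_hom[OF d X \<gamma>'] by blast
  have reverse: "(\<gamma>' \<sigma> + (- k (face X 2 0 \<sigma>) - (- k (face X 2 1 \<sigma>)) + - k (face X 2 2 \<sigma>))) mod int d =
      \<gamma> \<sigma> mod int d" if "\<sigma> \<in> simplices X 2" for \<sigma>
  proof -
    let ?c = "k (face X 2 0 \<sigma>) - k (face X 2 1 \<sigma>) + k (face X 2 2 \<sigma>)"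
    have "(\<gamma>' \<sigma> - ?c) mod int d = (\<gamma> \<sigma> + ?c - ?c) mod int d"
      using \<gamma>'[OF that] by (metis mod_diff_left_eq)
    then show ?thesis by (simp add: algebra_simps)
  qed
  obtain g where g: "g \<in> hom (Gamma d X \<gamma>') (Gamma d X \<gamma>)"
    "g (Gamma_gen d X \<gamma>' SymJ) = Gamma_gen d X \<gamma> SymJ"
    "\<And>x. x \<in> simplices X 1 \<Longrightarrow> g (Gamma_gen d X \<gamma>' (SymE x)) =
      Gamma_gen d X \<gamma> SymJ [^]\<^bsub>Gamma d X \<gamma>\<^esub> (- k x) \<otimes>\<^bsub>Gamma d X \<gamma>\<^esub> Gamma_gen d X \<gamma> (SymE x)"
    using Gamma_shift_hom[where k = "\<lambda>x. - k x", OF d X reverse] by blast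
  \<comment> \<open>generic in the cocycles and the cochain, so that it covers both compositions\<close>
  have inverse: "g (f (Gamma_gen d X \<gamma> s)) = Gamma_gen d X \<gamma> s"
    if s: "s \<in> solution_syms (simplices X 1)"
      and f: "f \<in> hom (Gamma d X \<gamma>) (Gamma d X \<gamma>')"
        "f (Gamma_gen d X \<gamma> SymJ) = Gamma_gen d X \<gamma>' SymJ"
        "\<And>x. x \<in> simplices X 1 \<Longrightarrow> f (Gamma_gen d X \<gamma> (SymE x)) =
          Gamma_gen d X \<gamma>' SymJ [^]\<^bsub>Gamma d X \<gamma>'\<^esub> k x \<otimes>\<^bsub>Gamma d X \<gamma>'\<^esub> Gamma_gen d X \<gamma>' (SymE x)"
      and g: "g \<in> hom (Gamma d X \<gamma>') (Gamma d X \<gamma>)"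
        "g (Gamma_gen d X \<gamma>' SymJ) = Gamma_gen d X \<gamma> SymJ"
        "\<And>x. x \<in> simplices X 1 \<Longrightarrow> g (Gamma_gen d X \<gamma>' (SymE x)) =
          Gamma_gen d X \<gamma> SymJ [^]\<^bsub>Gamma d X \<gamma>\<^esub> (- k x) \<otimes>\<^bsub>Gamma d X \<gamma>\<^esub> Gamma_gen d X \<gamma> (SymE x)"
    for f g s \<gamma> \<gamma>' and k :: "'a \<Rightarrow> int"
  proof -
    interpret G: group "Gamma d X \<gamma>" by (rule group_Gamma)
    interpret g: group_hom "Gamma d X \<gamma>'" "Gamma d X \<gamma>" g
      using g(1) by (intro group_hom.intro group_hom_axioms.intro group_Gamma)
    note S = twisted_solutionD[OF twisted_solution_Gamma_gen[OF d X, of \<gamma>]]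
    note S' = twisted_solutionD[OF twisted_solution_Gamma_gen[OF d X, of \<gamma>']]
    show ?thesis
      using solution_syms_cases[OF s]
    proof
      assume "s = SymJ"
      then show ?thesis by (simp add: f g)
    next
      assume "\<exists>x\<in>simplices X 1. s = SymE x"
      then obtain x where x: "x \<in> simplices X 1" "s = SymE x" by blast
      have "g (f (Gamma_gen d X \<gamma> (SymE x))) =
          Gamma_gen d X \<gamma> SymJ [^]\<^bsub>Gamma d X \<gamma>\<^esub> k x \<otimes>\<^bsub>Gamma d X \<gamma>\<^esub>
          (Gamma_gen d X \<gamma> SymJ [^]\<^bsub>Gamma d X \<gamma>\<^esub> (- k x) \<otimes>\<^bsub>Gamma d X \<gamma>\<^esub> Gamma_gen d X \<gamma> (SymE x))"
        using S'(1) S'(3)[OF x(1)] by (simp add: f(3)[OF x(1)] g(2) g(3)[OF x(1)] g.hom_int_pow)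
      also have "\<dots> = Gamma_gen d X \<gamma> (SymE x)"
        using S(1) S(3)[OF x(1)]
        by (simp add: G.m_assoc[symmetric] G.int_pow_mult[symmetric] del: G.int_pow_neg)
      finally show ?thesis by (simp add: x(2))
    qed
  qed
  have "g (f (Gamma_gen d X \<gamma> s)) = Gamma_gen d X \<gamma> s"
    if "s \<in> solution_syms (simplices X 1)" for s
    by (rule inverse[OF that f g])
  moreover have "f (g (Gamma_gen d X \<gamma>' s)) = Gamma_gen d X \<gamma>' s"
    if "s \<in> solution_syms (simplices X 1)" for s
    using f g by (intro inverse[OF that, where k = "\<lambda>x. - k x"]) simp_all
  ultimately have "f \<in> iso (Gamma d X \<gamma>) (Gamma d X \<gamma>')"
    using f(1) g(1)
    unfolding Gamma_def Gamma_gen_def solution_group_def solution_gen_def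
    by (intro presented_group_isoI[where g = g] solution_relators_closed)
  then show ?thesis by (rule is_isoI)
qed

text \<open>
  The zero coboundary plus \<open>\<gamma>\<close> lies in both cosets, hence is some coboundary plus \<open>\<gamma>'\<close>; it remains to
  evaluate this equation at triangles.
\<close>

lemma coho_class_eq_imp_coboundary:
  assumes X: "simplicial_set X"
    and eq: "coho_class d X 2 \<gamma> = coho_class d X 2 \<gamma>'"
  obtains k where "\<And>\<sigma>. \<sigma> \<in> simplices X 2 \<Longrightarrow>
      (\<gamma>' \<sigma> + (k (face X 2 0 \<sigma>) - k (face X 2 1 \<sigma>) + k (face X 2 2 \<sigma>))) mod int d = \<gamma> \<sigma> mod int d"
proof -
  let ?Z = "cocycle_group d X 2" and ?o = "\<lambda>_\<in>simplices X 1. 0 :: int"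
  have mult: "(f \<otimes>\<^bsub>?Z\<^esub> g) \<sigma> = (f \<sigma> + g \<sigma>) mod int d" if "\<sigma> \<in> simplices X 2" for f g \<sigma>
    using that by (simp add: cocycle_group_def cochains_def)
  have B: "coboundaries d X 2 = cobd d X 1 ` carrier (cochains d X 1)"
    by (simp add: coboundaries_def numeral_2_eq_2 One_nat_def)
  have cobd: "cobd d X 1 k \<sigma> =
      (k (face X 2 0 \<sigma>) - k (face X 2 1 \<sigma>) + k (face X 2 2 \<sigma>)) mod int d"
    if "\<sigma> \<in> simplices X 2" for k \<sigma>
    using that by (simp add: cobd_def numeral_2_eq_2 One_nat_def)
  have "?o \<in> carrier (cochains d X 1)"
    by (simp add: cochains_def)
  then have "cobd d X 1 ?o \<otimes>\<^bsub>?Z\<^esub> \<gamma> \<in> coho_class d X 2 \<gamma>"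
    unfolding coho_class_def r_coset_def B by blast
  then obtain k where k: "cobd d X 1 ?o \<otimes>\<^bsub>?Z\<^esub> \<gamma> = cobd d X 1 k \<otimes>\<^bsub>?Z\<^esub> \<gamma>'"
    unfolding eq unfolding coho_class_def r_coset_def B by blast
  show thesis
  proof (rule that)
    fix \<sigma> assume \<sigma>: "\<sigma> \<in> simplices X 2"
    have "face X 2 i \<sigma> \<in> simplices X 1" if "i \<le> 2" for i
      by (rule triangle_face_closed[OF X \<sigma> that])
    then have "cobd d X 1 ?o \<sigma> = 0" using \<sigma> by (simp add: cobd)
    then have "\<gamma> \<sigma> mod int d = (cobd d X 1 k \<sigma> + \<gamma>' \<sigma>) mod int d"
      using arg_cong[OF k, of "\<lambda>f. f \<sigma>"] \<sigma> by (simp add: mult)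
    then show "(\<gamma>' \<sigma> + (k (face X 2 0 \<sigma>) - k (face X 2 1 \<sigma>) + k (face X 2 2 \<sigma>))) mod int d =
        \<gamma> \<sigma> mod int d"
      by (simp add: cobd[OF \<sigma>] mod_simps add.commute)
  qed
qed

text \<open>
  The inverse sends \<open>J\<close> to \<open>\<epsilon>(1, s\<^sub>0 v)\<close> for some vertex \<open>v\<close> and \<open>e\<^sub>x\<close> to \<open>\<epsilon>(0, x)\<close>.
\<close>

lemma pi1_twisted_product_iso_Gamma:
  assumes d: "d > 1" and X: "simplicial_set X" "connected_sset X"
    and \<gamma>: "normalized_2cocycle d X \<gamma>"
  obtains f where "f \<in> iso (pi1 d (twisted_product d X \<gamma>)) (Gamma d X \<gamma>)"
    "\<And>a x. a \<in> carrier (integer_mod_group d) \<Longrightarrow> x \<in> simplices X 1 \<Longrightarrow>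
      f (pi1_gen d (twisted_product d X \<gamma>) ([a], x)) =
        (Gamma_gen d X \<gamma> SymJ [^]\<^bsub>Gamma d X \<gamma>\<^esub> a) \<otimes>\<^bsub>Gamma d X \<gamma>\<^esub> Gamma_gen d X \<gamma> (SymE x)"
proof -
  let ?Y = "twisted_product d X \<gamma>" and ?G = "Gamma d X \<gamma>" and ?gen = "Gamma_gen d X \<gamma>"
  let ?P = "pi1 d ?Y" and ?\<epsilon> = "pi1_gen d ?Y"
  note face_Y = twisted_product_face_closed[OF d X(1)]
  note sol_G = twisted_solution_Gamma_gen[OF d X(1), of \<gamma>]
  note S = twisted_solutionD[OF sol_G]
  interpret G: group ?G by (rule group_Gamma)
  have P: "group ?P" by (rule group_pi1[OF face_Y])
  obtain v where v: "v \<in> simplices X 0" using X(2) by (auto simp: connected_sset_def)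
  have s0v: "degen X 0 0 v \<in> simplices X 1"
    using simplicial_set_degen[OF X(1) v, of 0] by (simp add: One_nat_def)

  obtain f where f: "f \<in> hom ?P ?G"
    and f_gen: "\<And>y. y \<in> simplices ?Y 1 \<Longrightarrow>
      f (?\<epsilon> y) = (case y of (\<alpha>, x) \<Rightarrow> ?gen SymJ [^]\<^bsub>?G\<^esub> hd \<alpha> \<otimes>\<^bsub>?G\<^esub> ?gen (SymE x))"
    using pi1_universal[OF face_Y group_Gamma
        pi1_solution_twisted_product[OF group_Gamma d X(1) sol_G]] by blast
  have f_edge: "f (?\<epsilon> ([a], x)) = ?gen SymJ [^]\<^bsub>?G\<^esub> a \<otimes>\<^bsub>?G\<^esub> ?gen (SymE x)"
    if "a \<in> {0..<int d}" "x \<in> simplices X 1" for a x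
    using f_gen[of "([a], x)"] that by (simp add: simplices_twisted_product_1[OF d])

  have sol_P: "pi1_solution d ?Y ?P ?\<epsilon>" by (rule pi1_solution_pi1_gen) (rule face_Y)
  note tw = twisted_solution_of_pi1_solution[OF P d X \<gamma> sol_P v]
  obtain g where g: "g \<in> hom ?G ?P" "g (?gen SymJ) = ?\<epsilon> ([1], degen X 0 0 v)"
    "\<And>x. x \<in> simplices X 1 \<Longrightarrow> g (?gen (SymE x)) = ?\<epsilon> ([0], x)"
    using Gamma_universal[OF d X(1) P tw(1)] by blast
  interpret g: group_hom ?G ?P g
    using g(1) P by (intro group_hom.intro group_hom_axioms.intro group_Gamma)

  \<comment> \<open>The forward map takes \<open>\<epsilon>(1, s\<^sub>0 v)\<close> to \<open>J e\<^bsub>s\<^sub>0v\<^esub>\<close>; the row of the triangle \<open>s\<^sub>0 s\<^sub>0 v\<close> kills the second factor.\<close>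
  have e_s0v: "?gen (SymE (degen X 0 0 v)) = \<one>\<^bsub>?G\<^esub>"
  proof -
    let ?x = "degen X 0 0 v" and ?\<sigma> = "degen X 1 0 (degen X 0 0 v)"
    note D = degen_edge_faces[OF X(1) s0v]
    have "face X 1 1 ?x = v"
      using X(1)[unfolded simplicial_set_def] v by (metis One_nat_def le_refl)
    then have "face X 2 2 ?\<sigma> = ?x" using D(5) by simp
    moreover have "\<gamma> ?\<sigma> = 0" using \<gamma> s0v by (auto simp: normalized_2cocycle_def)
    ultimately have "?gen (SymE ?x) \<otimes>\<^bsub>?G\<^esub> ?gen (SymE ?x) = ?gen (SymE ?x)"
      using S(7)[OF D(1)] S(3)[OF s0v] by (simp add: D)
    then show ?thesis using S(3)[OF s0v] by (simp add: G.l_cancel_one)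
  qed
  have gf: "g (f (?\<epsilon> y)) = ?\<epsilon> y" if "y \<in> simplices ?Y 1" for y
  proof -
    obtain a x where y: "y = ([a], x)" "a \<in> {0..<int d}" "x \<in> simplices X 1"
      using \<open>y \<in> _\<close> by (auto simp: simplices_twisted_product_1[OF d])
    have "g (f (?\<epsilon> y)) = ?\<epsilon> ([1], degen X 0 0 v) [^]\<^bsub>?P\<^esub> a \<otimes>\<^bsub>?P\<^esub> ?\<epsilon> ([0], x)"
      unfolding y(1) f_edge[OF y(2,3)]
      using S(1) S(3)[OF y(3)] by (simp add: g.hom_int_pow g(2) g(3)[OF y(3)])
    also have "\<dots> = ?\<epsilon> y" unfolding y(1) by (rule tw(2)[OF y(2,3), symmetric])
    finally show ?thesis .
  qed
  have fg: "f (g (?gen s)) = ?gen s" if "s \<in> solution_syms (simplices X 1)" for s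
    using solution_syms_cases[OF that]
  proof
    assume "s = SymJ"
    then show ?thesis using f_edge[OF _ s0v, of 1] d S(1) by (simp add: g(2) e_s0v)
  next
    assume "\<exists>x\<in>simplices X 1. s = SymE x"
    then obtain x where x: "x \<in> simplices X 1" "s = SymE x" by blast
    show ?thesis using f_edge[OF _ x(1), of 0] d S(3)[OF x(1)] by (simp add: x(2) g(3)[OF x(1)])
  qed
  have "f \<in> iso ?P ?G"
    using f g(1) gf fg pi1_relators_closed[OF face_Y]
    unfolding pi1_def pi1_gen_def Gamma_def Gamma_gen_def solution_group_def solution_gen_def
    by (intro presented_group_isoI[where g = g] solution_relators_closed)
  then show thesis
    using f_edge d by (intro that) (auto simp: carrier_integer_mod_group)
qed

theorem theorem3p11:
  fixes d :: nat and X :: "'a sset" and \<gamma> :: "'a \<Rightarrow> int"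
  assumes "d > 1"
    and "simplicial_set X"
    and "connected_sset X"
    and "normalized_2cocycle d X \<gamma>"
  shows "(\<exists>f \<in> iso (pi1 d (twisted_product d X \<gamma>)) (Gamma d X \<gamma>).
           \<forall>a \<in> carrier (integer_mod_group d). \<forall>x \<in> simplices X 1.
             f (pi1_gen d (twisted_product d X \<gamma>) ([a], x)) =
               (Gamma_gen d X \<gamma> SymJ [^]\<^bsub>Gamma d X \<gamma>\<^esub> a) \<otimes>\<^bsub>Gamma d X \<gamma>\<^esub>
               Gamma_gen d X \<gamma> (SymE x)) \<and>
         (\<forall>\<gamma>'. normalized_2cocycle d X \<gamma>' \<and> coho_class d X 2 \<gamma> = coho_class d X 2 \<gamma>' \<longrightarrow>
           Gamma d X \<gamma> \<cong> Gamma d X \<gamma>')"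
proof (intro conjI allI impI)
  show "\<exists>f \<in> iso (pi1 d (twisted_product d X \<gamma>)) (Gamma d X \<gamma>).
           \<forall>a \<in> carrier (integer_mod_group d). \<forall>x \<in> simplices X 1.
             f (pi1_gen d (twisted_product d X \<gamma>) ([a], x)) =
               (Gamma_gen d X \<gamma> SymJ [^]\<^bsub>Gamma d X \<gamma>\<^esub> a) \<otimes>\<^bsub>Gamma d X \<gamma>\<^esub>
               Gamma_gen d X \<gamma> (SymE x)"
    using pi1_twisted_product_iso_Gamma[OF assms] by metis
next
  fix \<gamma>' assume "normalized_2cocycle d X \<gamma>' \<and> coho_class d X 2 \<gamma> = coho_class d X 2 \<gamma>'"
  then have "coho_class d X 2 \<gamma>' = coho_class d X 2 \<gamma>" by simp
  from coho_class_eq_imp_coboundary[OF assms(2) this] obtain k where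
    "\<And>\<sigma>. \<sigma> \<in> simplices X 2 \<Longrightarrow>
      (\<gamma> \<sigma> + (k (face X 2 0 \<sigma>) - k (face X 2 1 \<sigma>) + k (face X 2 2 \<sigma>))) mod int d = \<gamma>' \<sigma> mod int d"
    by blast
  then show "Gamma d X \<gamma> \<cong> Gamma d X \<gamma>'"
    by (rule Gamma_iso_of_cohomologous[OF assms(1,2)])
qed

end
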